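(* Consider the Riemann problem for the instantaneous kinematic wave model of diverging traffic $$\rho_t+\big(\rho V(\rho+k)\big)_x=0,\qquad k_t=0,$$ for $U=(k,\rho)$, with data $\rho(x,0)=\rho_L$, $k(x,0)=k_L$ for $x<0$ and $\rho(x,0)=\rho_R$, $k(x,0)=0$ for $x>0$. Write $U_L=(k_L,\rho_L)$, $U_R=(0,\rho_R)$, $Q(U)=Q(\rho;k)=\rho V(\rho+k)$. Under the entropy conditions described in the context, its wave solution is one of the following seven types (waves are listed from left to right; some waves may be trivial). Suppose first that $\rho_L<\gamma(k_L)$ ($U_L$ undercritical), and let $\rho_1\le\gamma(0)\le\rho_2$ be the solutions of $Q(\rho;0)=Q(U_L)$. 1. If $\rho_R\in[0,\rho_1]$: a standing wave $(U_L,U_1)$, then a rarefaction wave $(U_1,U_R)$, with $U_1=(0,\rho_1)$. 2. If $\rho_R\in(\rho_1,\rho_2)$: a standing wave $(U_L,U_1)$, then a shock wave $(U_1,U_R)$ of positive speed, with $U_1=(0,\rho_1)$. 3. If $\rho_R\in[\rho_2,\rho_j]$: a shock wave $(U_L,U_1)$ of nonpositive speed, then a standing wave $(U_1,U_R)$, where $U_1$ has $k$-component $k_L$, lies on the overcritical side, and $Q(U_1)=Q(U_R)$. Suppose next that $\rho_L>\gamma(k_L)$ ($U_L$ overcritical), and let $U_*=(k_L,\gamma(k_L))$. Let $\rho_0\ge\gamma(0)$ solve $Q(\rho_0;0)=Q(U_L)$, and let $\rho_1\le\gamma(0)\le\rho_2$ be the solutions of $Q(\rho;0)=Q(U_* )=Q^{\max}(k_L)$.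 4. If $\rho_R\in[0,\rho_1]$: a rarefaction wave $(U_L,U_* )$, a standing wave $(U_*,U_1)$, then a rarefaction wave $(U_1,U_R)$, with $U_1=(0,\rho_1)$. 5. If $\rho_R\in(\rho_1,\rho_2)$: a rarefaction wave $(U_L,U_* )$, a standing wave $(U_*,U_1)$, then a shock wave $(U_1,U_R)$ of positive speed, with $U_1=(0,\rho_1)$. 6. If $\rho_R\in[\rho_2,\rho_0]$: a rarefaction wave $(U_L,U_1)$, then a standing wave $(U_1,U_R)$, where $U_1$ has $k$-component $k_L$, lies on the overcritical side, and $Q(U_1)=Q(U_R)$. 7. If $\rho_R\in(\rho_0,\rho_j]$: a shock wave $(U_L,U_1)$ of negative speed, then a standing wave $(U_1,U_R)$, with $U_1$ characterized as in type 6. Moreover, the boundary flux $q(x=0,t>0)$ is $Q(U_L)$ for types 1, 2; $Q(U_R)$ for types 3, 6, 7; $Q^{\max}(k_L)$ for types 4, 5. Consequently $$q(x=0,t>0)=\min\{S_1,\,D(\rho_L;k_L)\},$$ where the partial traffic demand is $D(\rho_L;k_L)=Q(U_L)$ if $U_L$ is undercritical and $Q^{\max}(k_L)$ otherwise, and the downstream supply is $S_1=Q(U_R)$ if $U_R$ is overcritical and $Q^{\max}(0)$ otherwise.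
   Context: Here $\rho$ is the density of the vehicles heading for a given downstream branch of a diverge located at $x=0$, and $k$ is the total density of vehicles heading elsewhere (frozen in time). The densities satisfy $0\le k_L\le\rho_j$, $0\le\rho_L\le\rho_j-k_L$, $0\le\rho_R\le\rho_j$, where $\rho_j$ is the jam density. The speed-density function $V$ is smooth and nonincreasing on $[0,\rho_j]$ with $V(\rho_j)=0$, and $\rho V(\rho)$ is concave with $\frac{d^2}{d\rho^2}(\rho V(\rho))<0$; consequently, for each $k$, $Q(\rho;k)=\rho V(\rho+k)$ is strictly concave in $\rho\in[0,\rho_j-k]$, and $Q$ is nonincreasing in $k$. The partial capacity is $Q^{\max}(k)=\max_{\rho\in[0,\rho_j-k]}Q(\rho;k)$, attained at the unique partial critical density $\gamma(k)$. A state $(k,\rho)$ is undercritical if $\rho<\gamma(k)$, overcritical if $\rho>\gamma(k)$, and critical if $\rho=\gamma(k)$; "on the overcritical side" means $\rho\ge\gamma(k)$. The transition curve is $\Gamma=\{(k,\gamma(k)):k\in[0,\rho_j]\}$. The eigenvalues of the system are $\lambda_0=0$ and $\lambda_1(U)=V(\rho+k)+\rho V'(\rho+k)$. Elementary waves from a left state $U_-$ to a right state $U_+$: a standing wave is a stationary discontinuity at $x=0$ with $Q(U_-)=Q(U_+)$; a shock wave has $k_-=k_+$, $\rho_-<\rho_+$ and speed $\frac{Q(U_+)-Q(U_-)}{\rho_+-\rho_-}$; a rarefaction wave has $k_-=k_+$, $\rho_->\rho_+$ and is a centered simple wave with characteristic speed $\lambda_1$ ranging from $\lambda_1(U_-)$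 to $\lambda_1(U_+)$. A wave solution of the Riemann problem is a self-similar concatenation of elementary waves joining $U_L$ to $U_R$, subject to two entropy conditions: (Lax) wave speeds increase (weakly) from left to right; (Isaacson-Temple) an undercritical state and an overcritical state cannot be connected by a standing wave. *)

theory Defs
  imports "HOL-Analysis.Analysis"
begin

section \<open>Speed-density functions\<close>

text \<open>\<open>V\<close> is only meaningful on \<open>{0..\<rho>j}\<close>, so all derivatives are taken within that interval
  (one-sided at its end points).\<close>

definition deriv_within :: "real set \<Rightarrow> (real \<Rightarrow> real) \<Rightarrow> real \<Rightarrow> real" where
  "deriv_within S f x = vector_derivative f (at x within S)"

definition smooth_within :: "real set \<Rightarrow> (real \<Rightarrow> real) \<Rightarrow> bool" where
  "smooth_within S f \<longleftrightarrow> (\<forall>n. (deriv_within S ^^ n) f differentiable_on S)"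

definition speed_density :: "(real \<Rightarrow> real) \<Rightarrow> real \<Rightarrow> bool" where
  "speed_density V \<rho>j \<longleftrightarrow>
     0 < \<rho>j \<and>
     smooth_within {0..\<rho>j} V \<and>
     antimono_on {0..\<rho>j} V \<and>
     V \<rho>j = 0 \<and>
     concave_on {0..\<rho>j} (\<lambda>\<rho>. \<rho> * V \<rho>) \<and>
     (\<forall>\<rho>\<in>{0..\<rho>j}. (deriv_within {0..\<rho>j} ^^ 2) (\<lambda>r. r * V r) \<rho> < 0)"

section \<open>States\<close>

text \<open>A state is a pair \<open>(k, \<rho>)\<close>.\<close>

type_synonym state = "real \<times> real"

definition phase_space :: "real \<Rightarrow> state set" where
  "phase_space \<rho>j = {(k, \<rho>). 0 \<le> k \<and> k \<le> \<rho>j \<and> 0 \<le> \<rho> \<and> \<rho> \<le> \<rho>j - k}"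

fun flux :: "(real \<Rightarrow> real) \<Rightarrow> state \<Rightarrow> real" where
  "flux V (k, \<rho>) = \<rho> * V (\<rho> + k)"

definition capacity :: "(real \<Rightarrow> real) \<Rightarrow> real \<Rightarrow> real \<Rightarrow> real" where
  "capacity V \<rho>j k = (SUP \<rho>\<in>{0..\<rho>j - k}. flux V (k, \<rho>))"

definition crit_density :: "(real \<Rightarrow> real) \<Rightarrow> real \<Rightarrow> real \<Rightarrow> real" where
  "crit_density V \<rho>j k = arg_max_on (\<lambda>\<rho>. flux V (k, \<rho>)) {0..\<rho>j - k}"

fun undercritical :: "(real \<Rightarrow> real) \<Rightarrow> real \<Rightarrow> state \<Rightarrow> bool" where
  "undercritical V \<rho>j (k, \<rho>) \<longleftrightarrow> \<rho> < crit_density V \<rho>j k"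

fun overcritical :: "(real \<Rightarrow> real) \<Rightarrow> real \<Rightarrow> state \<Rightarrow> bool" where
  "overcritical V \<rho>j (k, \<rho>) \<longleftrightarrow> \<rho> > crit_density V \<rho>j k"

fun char_speed :: "(real \<Rightarrow> real) \<Rightarrow> real \<Rightarrow> state \<Rightarrow> real" where
  "char_speed V \<rho>j (k, \<rho>) = V (\<rho> + k) + \<rho> * deriv_within {0..\<rho>j} V (\<rho> + k)"

definition traffic_demand :: "(real \<Rightarrow> real) \<Rightarrow> real \<Rightarrow> state \<Rightarrow> real" where
  "traffic_demand V \<rho>j U = (if undercritical V \<rho>j U then flux V U else capacity V \<rho>j (fst U))"

definition traffic_supply :: "(real \<Rightarrow> real) \<Rightarrow> real \<Rightarrow> state \<Rightarrow> real" where
  "traffic_supply V \<rho>j U = (if overcritical V \<rho>j U then flux V U else capacity V \<rho>j (fst U))"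

section \<open>Elementary waves\<close>

datatype wave =
    Standing (lstate: state) (rstate: state)
  | Shock (lstate: state) (rstate: state)
  | Rarefaction (lstate: state) (rstate: state)

definition shock_speed :: "(real \<Rightarrow> real) \<Rightarrow> state \<Rightarrow> state \<Rightarrow> real" where
  "shock_speed V U W = (flux V W - flux V U) / (snd W - snd U)"

fun elementary :: "(real \<Rightarrow> real) \<Rightarrow> wave \<Rightarrow> bool" where
  "elementary V (Standing U W) \<longleftrightarrow> U \<noteq> W \<and> flux V U = flux V W"
| "elementary V (Shock U W) \<longleftrightarrow> fst U = fst W \<and> snd U < snd W"
| "elementary V (Rarefaction U W) \<longleftrightarrow> fst U = fst W \<and> snd U > snd W"

fun min_speed :: "(real \<Rightarrow> real) \<Rightarrow> real \<Rightarrow> wave \<Rightarrow> real" where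
  "min_speed V \<rho>j (Standing U W) = 0"
| "min_speed V \<rho>j (Shock U W) = shock_speed V U W"
| "min_speed V \<rho>j (Rarefaction U W) = char_speed V \<rho>j U"

fun max_speed :: "(real \<Rightarrow> real) \<Rightarrow> real \<Rightarrow> wave \<Rightarrow> real" where
  "max_speed V \<rho>j (Standing U W) = 0"
| "max_speed V \<rho>j (Shock U W) = shock_speed V U W"
| "max_speed V \<rho>j (Rarefaction U W) = char_speed V \<rho>j W"

definition lax :: "(real \<Rightarrow> real) \<Rightarrow> real \<Rightarrow> wave list \<Rightarrow> bool" where
  "lax V \<rho>j ws \<longleftrightarrow> successively (\<lambda>w w'. max_speed V \<rho>j w \<le> min_speed V \<rho>j w') ws"

fun isaacson_temple :: "(real \<Rightarrow> real) \<Rightarrow> real \<Rightarrow> wave \<Rightarrow> bool" where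
  "isaacson_temple V \<rho>j (Standing U W) \<longleftrightarrow>
     \<not> (undercritical V \<rho>j U \<and> overcritical V \<rho>j W) \<and>
     \<not> (overcritical V \<rho>j U \<and> undercritical V \<rho>j W)"
| "isaacson_temple V \<rho>j _ \<longleftrightarrow> True"

fun joins :: "state \<Rightarrow> wave list \<Rightarrow> state \<Rightarrow> bool" where
  "joins U [] W \<longleftrightarrow> U = W"
| "joins U (w # ws) W \<longleftrightarrow> lstate w = U \<and> joins (rstate w) ws W"

section \<open>Wave solutions\<close>

text \<open>The centered simple wave: along \<open>\<xi> = x / t\<close> the characteristic speed equals \<open>\<xi>\<close>.\<close>

definition fan :: "(real \<Rightarrow> real) \<Rightarrow> real \<Rightarrow> state \<Rightarrow> state \<Rightarrow> real \<Rightarrow> state" where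
  "fan V \<rho>j U W \<xi> =
     (fst U, THE \<rho>. \<rho> \<in> {snd W..snd U} \<and> char_speed V \<rho>j (fst U, \<rho>) = \<xi>)"

text \<open>The self-similar function of \<open>\<xi> = x / t\<close> that is \<open>U\<close> at the far left and then runs through
  the given waves. At a jump the state on the right is taken. Only rarefactions have
  \<open>min_speed < max_speed\<close>, so the middle branch concerns them alone.\<close>

fun profile :: "(real \<Rightarrow> real) \<Rightarrow> real \<Rightarrow> state \<Rightarrow> wave list \<Rightarrow> real \<Rightarrow> state" where
  "profile V \<rho>j U [] \<xi> = U"
| "profile V \<rho>j U (w # ws) \<xi> =
     (if \<xi> < min_speed V \<rho>j w then U
      else if \<xi> < max_speed V \<rho>j w then fan V \<rho>j (lstate w) (rstate w) \<xi>
      else profile V \<rho>j (rstate w) ws \<xi>)"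

text \<open>Since \<open>k\<close> is frozen in time, every state of the concatenation, including those in sectors of
  zero width at \<open>x = 0\<close>, has the \<open>k\<close>-component of one of the two initial states. Without this, two
  superposed standing waves through a critical state with a third value of \<open>k\<close> would connect
  overcritical to undercritical states and bypass the Isaacson-Temple condition.\<close>

definition solves_with_waves ::
    "(real \<Rightarrow> real) \<Rightarrow> real \<Rightarrow> state \<Rightarrow> state \<Rightarrow> wave list \<Rightarrow> (real \<Rightarrow> real \<Rightarrow> state) \<Rightarrow> bool" where
  "solves_with_waves V \<rho>j UL UR ws u \<longleftrightarrow>
     joins UL ws UR \<and>
     (\<forall>w\<in>set ws. elementary V w \<and> isaacson_temple V \<rho>j w \<and>
        {lstate w, rstate w} \<subseteq> phase_space \<rho>j \<and>
        {fst (lstate w), fst (rstate w)} \<subseteq> {fst UL, fst UR}) \<and>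
     lax V \<rho>j ws \<and>
     (\<forall>x<0. u x 0 = UL) \<and> (\<forall>x>0. u x 0 = UR) \<and>
     (\<forall>x. \<forall>t>0. u x t = profile V \<rho>j UL ws (x / t))"

definition wave_solution ::
    "(real \<Rightarrow> real) \<Rightarrow> real \<Rightarrow> state \<Rightarrow> state \<Rightarrow> (real \<Rightarrow> real \<Rightarrow> state) \<Rightarrow> bool" where
  "wave_solution V \<rho>j UL UR u \<longleftrightarrow> (\<exists>ws. solves_with_waves V \<rho>j UL UR ws u)"

text \<open>In a description of a solution by its waves, a listed wave between equal states means that
  there is no wave at that place.\<close>

definition has_waves ::
    "(real \<Rightarrow> real) \<Rightarrow> real \<Rightarrow> state \<Rightarrow> state \<Rightarrow> (real \<Rightarrow> real \<Rightarrow> state) \<Rightarrow> wave list \<Rightarrow> bool" where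
  "has_waves V \<rho>j UL UR u ws \<longleftrightarrow>
     solves_with_waves V \<rho>j UL UR (filter (\<lambda>w. lstate w \<noteq> rstate w) ws) u"

text \<open>\<open>q(x = 0, t > 0)\<close>: the common value of the two one-sided limits of the flux at \<open>x = 0\<close>.\<close>

definition boundary_flux :: "(real \<Rightarrow> real) \<Rightarrow> (real \<Rightarrow> real \<Rightarrow> state) \<Rightarrow> real \<Rightarrow> bool" where
  "boundary_flux V u q \<longleftrightarrow> (\<forall>t>0. ((\<lambda>x. flux V (u x t)) \<longlongrightarrow> q) (at 0))"

end

theory Submission
  imports Defs
begin

text \<open>
  Write \<open>Q k\<close> for the partial flux \<open>\<rho> V (\<rho> + k)\<close>, \<open>\<Lambda> k\<close> for its derivative, the characteristic speed, and
  \<open>\<gamma> k\<close> for the partial critical density. The hypotheses make \<open>V'\<close> strictly negative (\<open>V'_neg\<close>), and from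
  this follows that \<open>\<Lambda> k\<close> is strictly decreasing for every \<open>k\<close>. So \<open>Q k\<close> increases up to \<open>\<gamma> k\<close> and
  decreases after it, and the capacity at \<open>k > 0\<close> is strictly below the capacity at \<open>0\<close>.

  Among waves with the same \<open>k\<close> the Lax condition leaves only the empty list, a single shock, or a
  rarefaction, possibly listed in several pieces (\<open>nonstanding_waves\<close>). Standing waves have speed zero.
  Hence the Lax condition cuts every wave solution into three parts: waves with \<open>k = kL\<close> and speeds \<open>\<le> 0\<close>,
  from the upstream state to a trace \<open>(kL, a)\<close>; a stack of standing waves and resting shocks at the origin;
  and waves with \<open>k = 0\<close> and speeds \<open>\<ge> 0\<close>, from a trace \<open>(0, b)\<close> to the downstream state. The stack conserves
  the flux and, by the Isaacson-Temple condition, does not lead from an overcritical to an undercritical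
  state (\<open>zero_speed_stack\<close>). If \<open>kL = 0\<close>, the Isaacson-Temple condition excludes standing waves altogether,
  and the solution is constant, a single shock or a single rarefaction (\<open>connects_same_k\<close>).

  The upstream trace carries at most the demand, and exactly the demand unless \<open>a\<close> is strictly
  overcritical; the downstream trace carries at most the supply, and exactly the supply unless
  \<open>b \<le> \<gamma> 0\<close>. With the restriction on the stack the common flux must be the smaller of the two
  (\<open>traces_flux\<close>). The flux determines the traces up to a shock resting at the origin, and such a shock can
  be seen neither in \<open>x < 0\<close> nor in \<open>x \<ge> 0\<close>; so although several lists of waves may describe the solution,
  the solution itself is unique (\<open>glued_profile_unique\<close>). It therefore suffices, for each combination of
  initial states, to exhibit traces with equal flux on the same side of the transition curve, joined by one standing
  wave (\<open>wave_solution_by_traces\<close>).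
\<close>

section \<open>One-sided derivatives on intervals\<close>

lemma at_within_Icc_nontrivial:
  fixes a b x :: real
  assumes "a < b" "x \<in> {a..b}"
  shows "at x within {a..b} \<noteq> bot"
  using assms by (simp add: trivial_limit_within connected_imp_perfect)

lemma deriv_within_Icc:
  assumes "a < b" "x \<in> {a..b}" "(f has_real_derivative D) (at x within {a..b})"
  shows "deriv_within {a..b} f x = D"
  using vector_derivative_within_cbox[of a b x f D] assms
  by (simp add: deriv_within_def has_real_derivative_iff_has_vector_derivative)

lemma derivative_le_if_slopes_le:
  fixes f :: "real \<Rightarrow> real"
  assumes "(f has_real_derivative D) (at x within S)" "at x within S \<noteq> bot"
    and "\<And>y. y \<in> S \<Longrightarrow> y \<noteq> x \<Longrightarrow> (f y - f x) / (y - x) \<le> c"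
  shows "D \<le> c"
proof (rule tendsto_upperbound)
  show "((\<lambda>y. (f y - f x) / (y - x)) \<longlongrightarrow> D) (at x within S)"
    using assms(1) by (simp add: has_field_derivative_iff)
  show "\<forall>\<^sub>F y in at x within S. (f y - f x) / (y - x) \<le> c"
    using assms(3) by (simp add: eventually_at_filter)
qed (use assms in auto)

lemma strictly_decreasing_if_derivative_neg:
  fixes f :: "real \<Rightarrow> real"
  assumes "\<And>x. x \<in> {a..b} \<Longrightarrow> (f has_real_derivative f' x) (at x within {a..b})"
    and "\<And>x. x \<in> {a<..<b} \<Longrightarrow> f' x < 0" "a < b"
  shows "f b < f a"
proof -
  obtain x where "x \<in> {a<..<b}" "f b - f a = f' x * (b - a)"
    using mvt_simple[of a b f "\<lambda>x h. f' x * h"] assms by (auto simp: has_field_derivative_def)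
  then show ?thesis
    using assms(2)[of x] assms(3) mult_neg_pos[of "f' x" "b - a"] by simp
qed

section \<open>The speed-density function\<close>

locale fundamental_diagram =
  fixes V :: "real \<Rightarrow> real" and \<rho>j :: real
  assumes speed_density: "speed_density V \<rho>j"
begin

abbreviation Q :: "real \<Rightarrow> real \<Rightarrow> real" where "Q k \<rho> \<equiv> flux V (k, \<rho>)"
abbreviation \<gamma> :: "real \<Rightarrow> real" where "\<gamma> \<equiv> crit_density V \<rho>j"
abbreviation \<Lambda> :: "real \<Rightarrow> real \<Rightarrow> real" where "\<Lambda> k \<rho> \<equiv> char_speed V \<rho>j (k, \<rho>)"
abbreviation V' :: "real \<Rightarrow> real" where "V' \<equiv> deriv_within {0..\<rho>j} V"
abbreviation V'' :: "real \<Rightarrow> real" where "V'' \<equiv> deriv_within {0..\<rho>j} V'"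

lemma jam_density_pos: "0 < \<rho>j"
  and V_jam: "V \<rho>j = 0"
  using speed_density by (auto simp: speed_density_def)

lemma V_deriv: "s \<in> {0..\<rho>j} \<Longrightarrow> (V has_real_derivative V' s) (at s within {0..\<rho>j})"
proof -
  have "(deriv_within {0..\<rho>j} ^^ 0) V differentiable_on {0..\<rho>j}"
    using speed_density unfolding speed_density_def smooth_within_def by blast
  then show "s \<in> {0..\<rho>j} \<Longrightarrow> ?thesis"
    by (simp add: differentiable_on_def deriv_within_def vector_derivative_works
        has_real_derivative_iff_has_vector_derivative)
qed

lemma V'_deriv: "s \<in> {0..\<rho>j} \<Longrightarrow> (V' has_real_derivative V'' s) (at s within {0..\<rho>j})"
proof -
  have "(deriv_within {0..\<rho>j} ^^ 1) V differentiable_on {0..\<rho>j}"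
    using speed_density unfolding speed_density_def smooth_within_def by blast
  then have "V' differentiable_on {0..\<rho>j}"
    by simp
  then show "s \<in> {0..\<rho>j} \<Longrightarrow> ?thesis"
    unfolding deriv_within_def[of _ V']
    by (simp add: differentiable_on_def vector_derivative_works
        has_real_derivative_iff_has_vector_derivative)
qed

lemma flux_second_derivative_neg:
  assumes s: "s \<in> {0..\<rho>j}"
  shows "2 * V' s + s * V'' s < 0"
proof -
  let ?F = "\<lambda>r. r * V r"
  have 1: "deriv_within {0..\<rho>j} ?F r = V r + r * V' r" if "r \<in> {0..\<rho>j}" for r
    by (rule deriv_within_Icc[OF jam_density_pos that])
       (auto intro!: derivative_eq_intros V_deriv that)
  have "((\<lambda>r. V r + r * V' r) has_real_derivative 2 * V' s + s * V'' s) (at s within {0..\<rho>j})"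
    by (auto intro!: derivative_eq_intros V_deriv V'_deriv s)
  then have "(deriv_within {0..\<rho>j} ?F has_real_derivative 2 * V' s + s * V'' s) (at s within {0..\<rho>j})"
    unfolding has_real_derivative_iff_has_vector_derivative
    by (rule has_vector_derivative_transform[OF s, rotated]) (rule 1)
  then have "(deriv_within {0..\<rho>j} ^^ 2) ?F s = 2 * V' s + s * V'' s"
    by (simp add: numeral_2_eq_2 deriv_within_Icc[OF jam_density_pos s])
  moreover have "(deriv_within {0..\<rho>j} ^^ 2) ?F s < 0"
    using speed_density s unfolding speed_density_def by blast
  ultimately show ?thesis by simp
qed

text \<open>A zero of \<open>V'\<close> at \<open>s > 0\<close> would be a maximum of \<open>V' \<le> 0\<close>. The difference quotients of \<open>V'\<close> from
  the left would then make \<open>V''\<close> nonnegative there, and so \<open>2 V' + s V''\<close> too.\<close>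

lemma V'_neg:
  assumes s: "s \<in> {0..\<rho>j}"
  shows "V' s < 0"
proof (rule ccontr)
  have le: "V' r \<le> 0" if r: "r \<in> {0..\<rho>j}" for r
  proof (rule derivative_le_if_slopes_le[OF V_deriv[OF r]])
    show "at r within {0..\<rho>j} \<noteq> bot"
      using at_within_Icc_nontrivial jam_density_pos r by blast
    have mono: "V y \<le> V x" if "x \<in> {0..\<rho>j}" "y \<in> {0..\<rho>j}" "x \<le> y" for x y
      using speed_density that by (auto simp: speed_density_def monotone_on_def)
    show "(V y - V r) / (y - r) \<le> 0" if "y \<in> {0..\<rho>j}" "y \<noteq> r" for y
      using mono[of r y] mono[of y r] r that by (cases "r \<le> y") (auto simp: divide_simps)
  qed
  assume "\<not> V' s < 0"
  with le[OF s] have V's: "V' s = 0" by simp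
  with flux_second_derivative_neg[OF s] have "s \<noteq> 0" "s * V'' s < 0" by auto
  with s have "0 < s" by simp
  have "- V'' s \<le> 0"
  proof (rule derivative_le_if_slopes_le)
    have "(V' has_real_derivative V'' s) (at s within {0..s})"
      by (rule DERIV_subset[OF V'_deriv[OF s]]) (use s in auto)
    then show "((\<lambda>r. - V' r) has_real_derivative - V'' s) (at s within {0..s})"
      by (rule DERIV_minus)
    show "at s within {0..s} \<noteq> bot"
      using \<open>0 < s\<close> by (intro at_within_Icc_nontrivial) auto
    show "(- V' y - - V' s) / (y - s) \<le> 0" if "y \<in> {0..s}" "y \<noteq> s" for y
      using le[of y] that s V's by (auto simp: divide_simps)
  qed
  with \<open>0 < s\<close> \<open>s * V'' s < 0\<close> show False
    by (simp add: mult_less_0_iff)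
qed

lemma V_strict_decreasing:
  assumes "0 \<le> s" "s < t" "t \<le> \<rho>j"
  shows "V t < V s"
proof (rule strictly_decreasing_if_derivative_neg[where f = V and f' = V'])
  show "(V has_real_derivative V' x) (at x within {s..t})" if "x \<in> {s..t}" for x
    using V_deriv[of x] assms that by (auto intro: DERIV_subset)
qed (use assms V'_neg in auto)

lemma V_pos: "0 \<le> s \<Longrightarrow> s < \<rho>j \<Longrightarrow> 0 < V s"
  using V_strict_decreasing[of s \<rho>j] V_jam by simp

section \<open>Partial fluxes\<close>

context
  fixes k :: real
  assumes k: "0 \<le> k" "k \<le> \<rho>j"
begin

lemma shifted_deriv:
  assumes "\<And>s. s \<in> {0..\<rho>j} \<Longrightarrow> (f has_real_derivative f' s) (at s within {0..\<rho>j})"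
    and "\<rho> \<in> {0..\<rho>j - k}"
  shows "((\<lambda>r. f (r + k)) has_real_derivative f' (\<rho> + k)) (at \<rho> within {0..\<rho>j - k})"
proof -
  have "(f has_real_derivative f' (\<rho> + k)) (at (\<rho> + k) within (\<lambda>r. r + k) ` {0..\<rho>j - k})"
    using k assms by (intro DERIV_subset[OF assms(1)]) auto
  moreover have "((\<lambda>r. r + k) has_real_derivative 1) (at \<rho> within {0..\<rho>j - k})"
    by (auto intro!: derivative_eq_intros)
  ultimately show ?thesis
    using DERIV_image_chain[of f "f' (\<rho> + k)" "\<lambda>r. r + k" \<rho> "{0..\<rho>j - k}" 1] by (simp add: o_def)
qed

lemma Q_deriv:
  assumes "\<rho> \<in> {0..\<rho>j - k}"
  shows "(Q k has_real_derivative \<Lambda> k \<rho>) (at \<rho> within {0..\<rho>j - k})"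
  using assms by (auto intro!: derivative_eq_intros shifted_deriv[OF V_deriv])

lemma \<Lambda>_deriv:
  assumes "\<rho> \<in> {0..\<rho>j - k}"
  shows "(\<Lambda> k has_real_derivative 2 * V' (\<rho> + k) + \<rho> * V'' (\<rho> + k)) (at \<rho> within {0..\<rho>j - k})"
  using assms
  by (auto intro!: derivative_eq_intros shifted_deriv[OF V_deriv] shifted_deriv[OF V'_deriv])

text \<open>The shift by \<open>k\<close> keeps \<open>Q\<close> strictly concave: \<open>2 V' + \<rho> V''\<close> lies between \<open>2 V' < 0\<close> and the second
  derivative of the total flux at \<open>\<rho> + k\<close>.\<close>

lemma \<Lambda>_strict_decreasing:
  assumes "0 \<le> a" "a < b" "b \<le> \<rho>j - k"
  shows "\<Lambda> k b < \<Lambda> k a"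
proof (rule strictly_decreasing_if_derivative_neg[where f = "\<Lambda> k"])
  show "(\<Lambda> k has_real_derivative 2 * V' (x + k) + x * V'' (x + k)) (at x within {a..b})"
    if "x \<in> {a..b}" for x
    using \<Lambda>_deriv[of x] assms that by (auto intro: DERIV_subset)
  show "2 * V' (x + k) + x * V'' (x + k) < 0" if "x \<in> {a<..<b}" for x
  proof (cases "0 \<le> V'' (x + k)")
    case True
    with k have "x * V'' (x + k) \<le> (x + k) * V'' (x + k)"
      by (intro mult_right_mono) auto
    then show ?thesis
      using flux_second_derivative_neg[of "x + k"] k assms that by auto
  next
    case False
    then have "x * V'' (x + k) \<le> 0"
      using that assms by (auto simp: mult_le_0_iff)
    then show ?thesis
      using V'_neg[of "x + k"] k assms that by auto
  qed
qed (use assms in auto)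

lemma \<Lambda>_less_iff:
  assumes "a \<in> {0..\<rho>j - k}" "b \<in> {0..\<rho>j - k}"
  shows "\<Lambda> k a < \<Lambda> k b \<longleftrightarrow> b < a"
  using \<Lambda>_strict_decreasing[of a b] \<Lambda>_strict_decreasing[of b a] assms
  by (cases a b rule: linorder_cases) (auto simp del: char_speed.simps)

lemma \<Lambda>_eq_iff:
  assumes "a \<in> {0..\<rho>j - k}" "b \<in> {0..\<rho>j - k}"
  shows "\<Lambda> k a = \<Lambda> k b \<longleftrightarrow> b = a"
  using \<Lambda>_less_iff[OF assms] \<Lambda>_less_iff[OF assms(2,1)]
  by (metis less_irrefl linorder_neqE_linordered_idom)

lemma Q_continuous: "continuous_on {0..\<rho>j - k} (Q k)"
  using Q_deriv by (rule DERIV_continuous_on)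

lemma \<Lambda>_continuous: "continuous_on {0..\<rho>j - k} (\<Lambda> k)"
  using \<Lambda>_deriv by (rule DERIV_continuous_on)

text \<open>A shock speed is a value of the characteristic speed strictly inside the jump. Hence two adjacent
  waves with the same \<open>k\<close> violate the Lax condition as soon as one of them is a shock.\<close>

lemma shock_speed_between:
  assumes "0 \<le> a" "a < b" "b \<le> \<rho>j - k"
  shows "\<Lambda> k b < shock_speed V (k, a) (k, b)" "shock_speed V (k, a) (k, b) < \<Lambda> k a"
proof -
  have "(Q k has_derivative (\<lambda>h. \<Lambda> k x * h)) (at x within {a..b})" if "a \<le> x" "x \<le> b" for x
    using Q_deriv[of x] assms that unfolding has_field_derivative_def
    by (auto elim!: has_derivative_subset)
  from mvt_simple[OF assms(2) this] obtain x where
    x: "x \<in> {a<..<b}" "Q k b - Q k a = \<Lambda> k x * (b - a)"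
    by auto
  then have "shock_speed V (k, a) (k, b) = \<Lambda> k x"
    using assms by (simp add: shock_speed_def del: flux.simps char_speed.simps)
  then show "\<Lambda> k b < shock_speed V (k, a) (k, b)" "shock_speed V (k, a) (k, b) < \<Lambda> k a"
    using x assms \<Lambda>_strict_decreasing by auto
qed

lemma Q_nonneg: "\<rho> \<in> {0..\<rho>j - k} \<Longrightarrow> 0 \<le> Q k \<rho>"
  using V_pos[of "\<rho> + k"] V_jam k by (cases "\<rho> + k = \<rho>j") auto

lemma Q_0 [simp]: "Q k 0 = 0" and Q_jam [simp]: "Q k (\<rho>j - k) = 0"
  using V_jam by auto

lemma \<gamma>_maximizes:
  shows \<gamma>_range: "\<gamma> k \<in> {0..\<rho>j - k}"
    and Q_le_Q\<gamma>: "\<rho> \<in> {0..\<rho>j - k} \<Longrightarrow> Q k \<rho> \<le> Q k (\<gamma> k)"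
proof -
  obtain x where x: "x \<in> {0..\<rho>j - k}" "\<And>y. y \<in> {0..\<rho>j - k} \<Longrightarrow> Q k y \<le> Q k x"
    using continuous_attains_sup[OF compact_Icc _ Q_continuous] k by auto
  have "\<gamma> k \<in> {0..\<rho>j - k} \<and> (\<forall>\<rho>\<in>{0..\<rho>j - k}. Q k \<rho> \<le> Q k (\<gamma> k))"
    unfolding crit_density_def arg_max_on_def
    by (rule arg_maxI[where x = x]) (use x in \<open>force simp: not_less\<close>)+
  then show "\<gamma> k \<in> {0..\<rho>j - k}" "\<rho> \<in> {0..\<rho>j - k} \<Longrightarrow> Q k \<rho> \<le> Q k (\<gamma> k)"
    by blast+
qed

lemma capacity_eq: "capacity V \<rho>j k = Q k (\<gamma> k)"
  unfolding capacity_def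
  by (rule cSup_eq_maximum) (use \<gamma>_range Q_le_Q\<gamma> in \<open>auto simp del: flux.simps\<close>)

lemma \<gamma>_pos:
  assumes "k < \<rho>j"
  shows "0 < \<gamma> k" "\<gamma> k < \<rho>j - k" "0 < Q k (\<gamma> k)"
proof -
  have "0 < Q k ((\<rho>j - k) / 2)"
    using assms k V_pos[of "(\<rho>j - k) / 2 + k"] by (auto simp: field_simps)
  also have "\<dots> \<le> Q k (\<gamma> k)"
    using assms by (intro Q_le_Q\<gamma>) auto
  finally show *: "0 < Q k (\<gamma> k)" .
  then have "\<gamma> k \<noteq> 0" "\<gamma> k \<noteq> \<rho>j - k"
    using V_jam by auto
  then show "0 < \<gamma> k" "\<gamma> k < \<rho>j - k"
    using \<gamma>_range by auto
qed

text \<open>At \<open>k = \<rho>j\<close> the range of densities is a single point, and the characteristic speed vanishes there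
  because \<open>V \<rho>j = 0\<close>; in this way all signs below hold up to the jam.\<close>

lemma \<Lambda>_\<gamma>: "\<Lambda> k (\<gamma> k) = 0"
proof (cases "k = \<rho>j")
  case True
  then show ?thesis using \<gamma>_range V_jam by simp
next
  case False
  then have i: "\<gamma> k \<in> {0<..<\<rho>j - k}" using \<gamma>_pos k by auto
  have "at (\<gamma> k) within {0..\<rho>j - k} = at (\<gamma> k)"
    using i by (intro at_within_interior) auto
  then have d: "(Q k has_real_derivative \<Lambda> k (\<gamma> k)) (at (\<gamma> k))"
    using Q_deriv[OF \<gamma>_range] by simp
  show ?thesis
  proof (rule DERIV_local_max[OF d])
    show "0 < min (\<gamma> k) (\<rho>j - k - \<gamma> k)" using i by auto
    show "\<forall>y. \<bar>\<gamma> k - y\<bar> < min (\<gamma> k) (\<rho>j - k - \<gamma> k) \<longrightarrow> Q k y \<le> Q k (\<gamma> k)"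
      using i by (auto intro!: Q_le_Q\<gamma> simp del: flux.simps)
  qed
qed

lemma \<Lambda>_sign:
  assumes "\<rho> \<in> {0..\<rho>j - k}"
  shows "\<Lambda> k \<rho> < 0 \<longleftrightarrow> \<gamma> k < \<rho>" "0 < \<Lambda> k \<rho> \<longleftrightarrow> \<rho> < \<gamma> k"
    "\<Lambda> k \<rho> \<le> 0 \<longleftrightarrow> \<gamma> k \<le> \<rho>" "0 \<le> \<Lambda> k \<rho> \<longleftrightarrow> \<rho> \<le> \<gamma> k"
  using \<Lambda>_less_iff[OF assms \<gamma>_range] \<Lambda>_less_iff[OF \<gamma>_range assms] \<Lambda>_\<gamma>
  by (simp_all del: char_speed.simps add: not_less[symmetric])

lemma shock_speed_sign:
  assumes "a < b"
  shows "shock_speed V (k, a) (k, b) \<le> 0 \<longleftrightarrow> Q k b \<le> Q k a"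
    "0 \<le> shock_speed V (k, a) (k, b) \<longleftrightarrow> Q k a \<le> Q k b"
  using assms by (simp_all add: shock_speed_def divide_le_0_iff zero_le_divide_iff del: flux.simps)

lemma Q_increasing:
  assumes "0 \<le> a" "a < b" "b \<le> \<gamma> k"
  shows "Q k a < Q k b"
proof -
  have "b \<le> \<rho>j - k" using assms \<gamma>_range by simp
  then have "0 \<le> \<Lambda> k b" "b \<in> {0..\<rho>j - k}" using assms \<Lambda>_sign(4)[of b] by auto
  then have "\<not> shock_speed V (k, a) (k, b) \<le> 0"
    using shock_speed_between(1)[of a b] assms by auto
  then show ?thesis using shock_speed_sign assms by force
qed

lemma Q_decreasing:
  assumes "\<gamma> k \<le> a" "a < b" "b \<le> \<rho>j - k"
  shows "Q k b < Q k a"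
proof -
  have "0 \<le> a" using assms \<gamma>_range by simp
  then have "\<Lambda> k a \<le> 0" "a \<in> {0..\<rho>j - k}" using assms \<Lambda>_sign(3)[of a] by auto
  then have "\<not> 0 \<le> shock_speed V (k, a) (k, b)"
    using shock_speed_between(2)[of a b] assms \<open>0 \<le> a\<close> by auto
  then show ?thesis using shock_speed_sign assms by force
qed

lemma Q_inj_under: "a \<in> {0..\<gamma> k} \<Longrightarrow> b \<in> {0..\<gamma> k} \<Longrightarrow> Q k a = Q k b \<longleftrightarrow> a = b"
  using Q_increasing[of a b] Q_increasing[of b a] by (cases a b rule: linorder_cases) auto

lemma Q_inj_over: "a \<in> {\<gamma> k..\<rho>j - k} \<Longrightarrow> b \<in> {\<gamma> k..\<rho>j - k} \<Longrightarrow> Q k a = Q k b \<longleftrightarrow> a = b"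
  using Q_decreasing[of a b] Q_decreasing[of b a] by (cases a b rule: linorder_cases) auto

lemma Q_less_capacity:
  assumes "\<rho> \<in> {0..\<rho>j - k}" "\<rho> \<noteq> \<gamma> k"
  shows "Q k \<rho> < Q k (\<gamma> k)"
  using Q_increasing[of \<rho> "\<gamma> k"] Q_decreasing[of "\<gamma> k" \<rho>] assms
  by (cases \<rho> "\<gamma> k" rule: linorder_cases) auto

lemma under_root:
  assumes "0 \<le> f" "f \<le> Q k (\<gamma> k)"
  obtains \<rho> where "\<rho> \<in> {0..\<gamma> k}" "Q k \<rho> = f"
proof -
  have "continuous_on {0..\<gamma> k} (Q k)"
    using Q_continuous by (rule continuous_on_subset) (use \<gamma>_range in auto)
  then show ?thesis
    using IVT'[of "Q k" 0 f "\<gamma> k"] assms \<gamma>_range that by (auto simp del: flux.simps)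
qed

lemma over_root:
  assumes "0 \<le> f" "f \<le> Q k (\<gamma> k)"
  obtains \<rho> where "\<rho> \<in> {\<gamma> k..\<rho>j - k}" "Q k \<rho> = f"
proof -
  have "continuous_on {\<gamma> k..\<rho>j - k} (Q k)"
    using Q_continuous by (rule continuous_on_subset) (use \<gamma>_range in auto)
  then show ?thesis
    using IVT2'[of "Q k" "\<rho>j - k" f "\<gamma> k"] assms \<gamma>_range that by (auto simp del: flux.simps)
qed

end

text \<open>Strictness matters: a flux below the capacity at \<open>k\<close>, and for \<open>k > 0\<close> the capacity itself, is below
  the capacity at \<open>0\<close>, so no critical state with \<open>k = 0\<close> carries it.\<close>

lemma capacity_decreasing:
  assumes "0 < k" "k \<le> \<rho>j"
  shows "Q k (\<gamma> k) < Q 0 (\<gamma> 0)"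
proof (cases "k = \<rho>j")
  case True
  then show ?thesis
    using \<gamma>_range[of k] \<gamma>_pos(3)[of 0] jam_density_pos assms by simp
next
  case False
  then have "Q k (\<gamma> k) < Q 0 (\<gamma> k)"
    using \<gamma>_pos[of k] assms V_strict_decreasing[of "\<gamma> k" "\<gamma> k + k"] by simp
  also have "\<dots> \<le> Q 0 (\<gamma> 0)"
    using \<gamma>_range[of k] assms jam_density_pos by (intro Q_le_Q\<gamma>) auto
  finally show ?thesis .
qed

end

section \<open>Concatenations of waves\<close>

lemma joins_append: "joins U (A @ B) W \<longleftrightarrow> (\<exists>M. joins U A M \<and> joins M B W)"
  by (induction A arbitrary: U) auto

lemma profile_behind:
  assumes "joins U A M" "\<And>w. w \<in> set A \<Longrightarrow> min_speed V \<rho>j w \<le> \<xi> \<and> max_speed V \<rho>j w \<le> \<xi>"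
  shows "profile V \<rho>j U (A @ B) \<xi> = profile V \<rho>j M B \<xi>"
  using assms
proof (induction A arbitrary: U)
  case (Cons w A)
  have "\<not> \<xi> < min_speed V \<rho>j w" "\<not> \<xi> < max_speed V \<rho>j w"
    using Cons.prems(2)[of w] by auto
  then show ?case using Cons by auto
qed simp

lemma profile_ahead:
  assumes "joins U A M" "\<And>w. w \<in> set B \<Longrightarrow> \<xi> < min_speed V \<rho>j w"
  shows "profile V \<rho>j U (A @ B) \<xi> = profile V \<rho>j U A \<xi>"
  using assms
proof (induction A arbitrary: U)
  case Nil
  then show ?case by (cases B) auto
qed auto

lemma split_at_extreme_occurrences:
  assumes "\<exists>x\<in>set xs. P x"
  obtains A Z B where "xs = A @ Z @ B" "Z \<noteq> []" "P (hd Z)" "P (last Z)"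
    "\<forall>x\<in>set A. \<not> P x" "\<forall>x\<in>set B. \<not> P x"
proof -
  obtain A x R where x: "xs = A @ x # R" "P x" "\<forall>y\<in>set A. \<not> P y"
    using split_list_first_prop[OF assms] by blast
  show ?thesis
  proof (cases "\<exists>y\<in>set R. P y")
    case True
    then obtain M y B where "R = M @ y # B" "P y" "\<forall>z\<in>set B. \<not> P z"
      using split_list_last_prop[OF True] by blast
    then show ?thesis using x that[of A "x # M @ [y]" B] by simp
  next
    case False
    then show ?thesis using x that[of A "[x]" R] by simp
  qed
qed

context fundamental_diagram
begin

text \<open>The Isaacson-Temple condition is kept apart, because only standing waves are subject to it.\<close>

definition proper :: "wave \<Rightarrow> bool" where
  "proper w \<longleftrightarrow> elementary V w \<and> {lstate w, rstate w} \<subseteq> phase_space \<rho>j"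

lemma phase_space_iff: "(k, r) \<in> phase_space \<rho>j \<longleftrightarrow> 0 \<le> k \<and> k \<le> \<rho>j \<and> r \<in> {0..\<rho>j - k}"
  by (auto simp: phase_space_def)

lemma rarefaction_min_less_max:
  assumes "proper (Rarefaction U W)"
  shows "min_speed V \<rho>j (Rarefaction U W) < max_speed V \<rho>j (Rarefaction U W)"
  using assms \<Lambda>_strict_decreasing[of "fst U" "snd W" "snd U"]
  by (cases U; cases W) (auto simp: proper_def phase_space_iff simp del: char_speed.simps)

lemma min_le_max_speed: "proper w \<Longrightarrow> min_speed V \<rho>j w \<le> max_speed V \<rho>j w"
  using rarefaction_min_less_max by (cases w) (auto intro: less_imp_le)

text \<open>Lax's condition compares neighbours only; it orders all waves because no wave has its smallest
  speed above its largest one.\<close>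

lemma lax_sorted:
  assumes "lax V \<rho>j ws" "\<And>w. w \<in> set ws \<Longrightarrow> proper w"
  shows "sorted_wrt (\<lambda>w w'. max_speed V \<rho>j w \<le> min_speed V \<rho>j w') ws"
  using assms(1) unfolding lax_def
proof (subst (asm) successively_iff_sorted_wrt_strong)
  fix w w' w''
  assume "w' \<in> set ws" "max_speed V \<rho>j w \<le> min_speed V \<rho>j w'"
    "max_speed V \<rho>j w' \<le> min_speed V \<rho>j w''"
  then show "max_speed V \<rho>j w \<le> min_speed V \<rho>j w''"
    using min_le_max_speed[OF assms(2)] by fastforce
qed

section \<open>Rarefaction fans\<close>

context
  fixes k :: real
  assumes k: "0 \<le> k" "k \<le> \<rho>j"
begin

lemma \<Lambda>_root:
  assumes "0 \<le> b" "b \<le> a" "a \<le> \<rho>j - k" "\<Lambda> k a \<le> \<xi>" "\<xi> \<le> \<Lambda> k b"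
  obtains \<rho> where "\<rho> \<in> {b..a}" "\<Lambda> k \<rho> = \<xi>"
proof -
  have "continuous_on {b..a} (\<Lambda> k)"
    using \<Lambda>_continuous[OF k] by (rule continuous_on_subset) (use assms in auto)
  then show ?thesis
    using IVT2'[of "\<Lambda> k" a \<xi> b] assms that by (auto simp del: char_speed.simps)
qed

lemma fan_eq:
  assumes "0 \<le> b" "a \<le> \<rho>j - k" "\<rho> \<in> {b..a}"
  shows "fan V \<rho>j (k, a) (k, b) (\<Lambda> k \<rho>) = (k, \<rho>)"
proof -
  have "(THE r. r \<in> {b..a} \<and> \<Lambda> k r = \<Lambda> k \<rho>) = \<rho>"
    using assms \<Lambda>_eq_iff[OF k, of _ \<rho>] by (intro the_equality) (auto simp del: char_speed.simps)
  then show ?thesis by (simp add: fan_def del: char_speed.simps)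
qed

lemma rarefaction_profile:
  assumes "0 \<le> b" "b < a" "a \<le> \<rho>j - k" "\<rho> \<in> {b..a}"
  shows "profile V \<rho>j (k, a) [Rarefaction (k, a) (k, b)] (\<Lambda> k \<rho>) = (k, \<rho>)"
  using assms fan_eq[of b a \<rho>] \<Lambda>_less_iff[OF k, of \<rho> a] \<Lambda>_less_iff[OF k, of \<rho> b]
  by (auto simp del: char_speed.simps)

text \<open>Neighbouring rarefactions satisfy the Lax condition with equality, so a rarefaction can be listed in
  pieces; the function it describes stays the same.\<close>

lemma rarefaction_split:
  assumes "0 \<le> b" "b < c" "c < a" "a \<le> \<rho>j - k"
    and ws: "profile V \<rho>j (k, c) ws = profile V \<rho>j (k, c) [Rarefaction (k, c) (k, b)]"
  shows "profile V \<rho>j (k, a) (Rarefaction (k, a) (k, c) # ws) =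
    profile V \<rho>j (k, a) [Rarefaction (k, a) (k, b)]"
proof
  fix \<xi>
  let ?P = "\<lambda>a ws. profile V \<rho>j (k, a) ws"
  have ord: "\<Lambda> k a < \<Lambda> k c" "\<Lambda> k c < \<Lambda> k b"
    using \<Lambda>_strict_decreasing[OF k] assms by auto
  consider "\<xi> < \<Lambda> k a" | "\<Lambda> k a \<le> \<xi>" "\<xi> < \<Lambda> k c" | "\<Lambda> k c \<le> \<xi>" "\<xi> < \<Lambda> k b" | "\<Lambda> k b \<le> \<xi>"
    by linarith
  then show "?P a (Rarefaction (k, a) (k, c) # ws) \<xi> = ?P a [Rarefaction (k, a) (k, b)] \<xi>"
  proof cases
    case 1
    then show ?thesis by simp
  next
    case 2
    then obtain \<rho> where \<rho>: "\<rho> \<in> {c..a}" "\<Lambda> k \<rho> = \<xi>"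
      using \<Lambda>_root[of c a \<xi>] assms by (metis less_imp_le order_trans)
    have "?P a [Rarefaction (k, a) (k, b)] \<xi> = (k, \<rho>)"
      using rarefaction_profile[of b a \<rho>] \<rho> assms by (simp del: profile.simps char_speed.simps)
    then show ?thesis
      using 2 fan_eq[of c a \<rho>] \<rho> assms by (simp del: char_speed.simps)
  next
    case 3
    then obtain \<rho> where \<rho>: "\<rho> \<in> {b..c}" "\<Lambda> k \<rho> = \<xi>"
      using \<Lambda>_root[of b c \<xi>] assms by (metis less_imp_le order_trans)
    have "?P a [Rarefaction (k, a) (k, b)] \<xi> = (k, \<rho>)" "?P c [Rarefaction (k, c) (k, b)] \<xi> = (k, \<rho>)"
      using rarefaction_profile[of b a \<rho>] rarefaction_profile[of b c \<rho>] \<rho> assms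
      by (simp_all del: profile.simps char_speed.simps)
    then show ?thesis
      using 3 ord ws by (simp del: char_speed.simps)
  next
    case 4
    then show ?thesis
      using ord ws by (simp del: char_speed.simps)
  qed
qed

text \<open>Needed for a fan that reaches \<open>x = 0\<close>, where the boundary flux is a genuine limit; it exists because the
  inverse of the characteristic speed is continuous.\<close>

lemma rarefaction_flux_continuous:
  assumes "0 \<le> b" "b < a" "a \<le> \<rho>j - k"
  shows "continuous_on {\<Lambda> k a..\<Lambda> k b}
    (\<lambda>\<xi>. flux V (profile V \<rho>j (k, a) [Rarefaction (k, a) (k, b)] \<xi>))"
proof -
  let ?p = "profile V \<rho>j (k, a) [Rarefaction (k, a) (k, b)]"
  have p: "?p (\<Lambda> k \<rho>) = (k, \<rho>)" if "\<rho> \<in> {b..a}" for \<rho>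
    using rarefaction_profile[OF assms that] .
  have image: "{\<Lambda> k a..\<Lambda> k b} \<subseteq> \<Lambda> k ` {b..a}"
  proof
    fix \<xi> assume "\<xi> \<in> {\<Lambda> k a..\<Lambda> k b}"
    then obtain \<rho> where "\<rho> \<in> {b..a}" "\<Lambda> k \<rho> = \<xi>"
      using \<Lambda>_root[of b a \<xi>] assms by (metis atLeastAtMost_iff less_imp_le)
    then show "\<xi> \<in> \<Lambda> k ` {b..a}" by blast
  qed
  have "continuous_on (\<Lambda> k ` {b..a}) (snd \<circ> ?p)"
  proof (rule continuous_on_inv)
    show "continuous_on {b..a} (\<Lambda> k)"
      using \<Lambda>_continuous[OF k] by (rule continuous_on_subset) (use assms in auto)
  qed (use p in \<open>auto simp del: profile.simps char_speed.simps\<close>)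
  then have cont: "continuous_on {\<Lambda> k a..\<Lambda> k b} (snd \<circ> ?p)"
    by (rule continuous_on_subset) (rule image)
  have "continuous_on {\<Lambda> k a..\<Lambda> k b} (\<lambda>\<xi>. Q k ((snd \<circ> ?p) \<xi>))"
    by (rule continuous_on_compose2[OF Q_continuous[OF k] cont])
       (use image p assms in \<open>fastforce simp del: profile.simps char_speed.simps\<close>)
  moreover have "Q k ((snd \<circ> ?p) \<xi>) = flux V (?p \<xi>)" if "\<xi> \<in> {\<Lambda> k a..\<Lambda> k b}" for \<xi>
    using image p that by (auto simp del: profile.simps char_speed.simps flux.simps)
  ultimately show ?thesis
    by (rule continuous_on_eq)
qed

end

section \<open>Waves with constant k\<close>

definition link :: "real \<Rightarrow> real \<Rightarrow> real \<Rightarrow> wave list" where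
  "link k a b =
     (if a < b then [Shock (k, a) (k, b)] else if b < a then [Rarefaction (k, a) (k, b)] else [])"

lemma link_simps [simp]:
  "link k a a = []"
  "a < b \<Longrightarrow> link k a b = [Shock (k, a) (k, b)]"
  "b < a \<Longrightarrow> link k a b = [Rarefaction (k, a) (k, b)]"
  by (auto simp: link_def)

lemma joins_link: "joins (k, a) (link k a b) (k, b)"
  by (auto simp: link_def)

lemma link_waves:
  assumes "(k, a) \<in> phase_space \<rho>j" "(k, b) \<in> phase_space \<rho>j" "w \<in> set (link k a b)"
  shows "proper w" "isaacson_temple V \<rho>j w" "{fst (lstate w), fst (rstate w)} = {k}"
  using assms by (auto simp: link_def proper_def split: if_splits)

text \<open>Without standing waves \<open>k\<close> stays constant, and a shock tolerates no neighbour
  by the bounds on its speed. What remains, apart from single shocks, is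
  a rarefaction cut into pieces. So such a
  concatenation describes the same function as \<open>link\<close>, with the same extreme speeds.\<close>

lemma nonstanding_waves:
  assumes "\<And>w. w \<in> set ws \<Longrightarrow> proper w \<and> \<not> is_Standing w" "lax V \<rho>j ws"
    and "joins (k, a) ws (k', b)" "(k, a) \<in> phase_space \<rho>j"
  shows "k' = k \<and> (k, b) \<in> phase_space \<rho>j \<and>
    profile V \<rho>j (k, a) ws = profile V \<rho>j (k, a) (link k a b) \<and>
    (ws = [] \<longleftrightarrow> link k a b = []) \<and>
    (ws \<noteq> [] \<longrightarrow> min_speed V \<rho>j (hd ws) = min_speed V \<rho>j (hd (link k a b)) \<and>
      max_speed V \<rho>j (last ws) = max_speed V \<rho>j (last (link k a b)))"
  using assms
proof (induction ws arbitrary: a)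
  case Nil
  then show ?case by simp
next
  case (Cons w ws)
  have w: "proper w" "\<not> is_Standing w" "lstate w = (k, a)"
    using Cons.prems by auto
  then obtain c where c: "rstate w = (k, c)" "(k, c) \<in> phase_space \<rho>j"
    by (cases w; cases "rstate w") (auto simp: proper_def)
  then have k: "0 \<le> k" "k \<le> \<rho>j" and ac: "a \<in> {0..\<rho>j - k}" "c \<in> {0..\<rho>j - k}"
    using Cons.prems(4) by (auto simp: phase_space_iff)
  have lax: "lax V \<rho>j ws" "ws \<noteq> [] \<Longrightarrow> max_speed V \<rho>j w \<le> min_speed V \<rho>j (hd ws)"
    using Cons.prems(2) by (auto simp: lax_def successively_Cons)
  have IH: "k' = k \<and> (k, b) \<in> phase_space \<rho>j \<and>
    profile V \<rho>j (k, c) ws = profile V \<rho>j (k, c) (link k c b) \<and>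
    (ws = [] \<longleftrightarrow> link k c b = []) \<and>
    (ws \<noteq> [] \<longrightarrow> min_speed V \<rho>j (hd ws) = min_speed V \<rho>j (hd (link k c b)) \<and>
      max_speed V \<rho>j (last ws) = max_speed V \<rho>j (last (link k c b)))"
    using Cons.prems c by (intro Cons.IH lax) auto
  then have b: "b \<in> {0..\<rho>j - k}" by (simp add: phase_space_iff)
  have wcases: "w = Shock (k, a) (k, c) \<and> a < c \<or> w = Rarefaction (k, a) (k, c) \<and> c < a"
    using w c by (cases w) (auto simp: proper_def)
  show ?case
  proof (cases "ws = []")
    case True
    then have "c = b" using IH by (auto simp: link_def split: if_splits)
    then show ?thesis using True wcases IH by auto
  next
    case False
    then have speed: "max_speed V \<rho>j w \<le> min_speed V \<rho>j (hd (link k c b))" and "c \<noteq> b"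
      using IH lax by auto
    have "w = Rarefaction (k, a) (k, c) \<and> c < a \<and> b < c"
      using wcases speed \<open>c \<noteq> b\<close> ac b shock_speed_between[OF k, of a c] shock_speed_between[OF k, of c b]
      by (cases b c rule: linorder_cases) (auto simp del: char_speed.simps)
    then show ?thesis
      using rarefaction_split[OF k, of b c a ws] IH False ac b
      by (simp del: char_speed.simps profile.simps)
  qed
qed

section \<open>Admissible traces at the origin\<close>

text \<open>The states \<open>(k, a)\<close> that can be reached from \<open>(k, r)\<close> by waves that stay in \<open>x \<le> 0\<close>, and the states
  \<open>(k, b)\<close> from which \<open>(k, s)\<close> can be reached by waves that stay in \<open>x \<ge> 0\<close>.\<close>

definition left_trace :: "real \<Rightarrow> real \<Rightarrow> real \<Rightarrow> bool" where
  "left_trace k r a \<longleftrightarrow> a \<in> {0..\<rho>j - k} \<and> (\<forall>w\<in>set (link k r a). max_speed V \<rho>j w \<le> 0)"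

definition right_trace :: "real \<Rightarrow> real \<Rightarrow> real \<Rightarrow> bool" where
  "right_trace k b s \<longleftrightarrow> b \<in> {0..\<rho>j - k} \<and> (\<forall>w\<in>set (link k b s). 0 \<le> min_speed V \<rho>j w)"

abbreviation partial_demand :: "real \<Rightarrow> real \<Rightarrow> real" where
  "partial_demand k r \<equiv> traffic_demand V \<rho>j (k, r)"
abbreviation partial_supply :: "real \<Rightarrow> real \<Rightarrow> real" where
  "partial_supply k s \<equiv> traffic_supply V \<rho>j (k, s)"

lemma demand_eq: "0 \<le> k \<Longrightarrow> k \<le> \<rho>j \<Longrightarrow> partial_demand k r = (if r < \<gamma> k then Q k r else Q k (\<gamma> k))"
  and supply_eq: "0 \<le> k \<Longrightarrow> k \<le> \<rho>j \<Longrightarrow> partial_supply k s = (if \<gamma> k < s then Q k s else Q k (\<gamma> k))"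
  by (simp_all add: traffic_demand_def traffic_supply_def capacity_eq del: flux.simps)

context
  fixes k r :: real
  assumes k: "0 \<le> k" "k \<le> \<rho>j" and r: "r \<in> {0..\<rho>j - k}"
begin

lemma left_trace_iff:
  "left_trace k r a \<longleftrightarrow> a \<in> {0..\<rho>j - k} \<and> (a = r \<or> r < a \<and> Q k a \<le> Q k r \<or> \<gamma> k \<le> a \<and> a < r)"
  using shock_speed_sign(1)[OF k, of r a] \<Lambda>_sign(3)[OF k, of a]
  by (cases r a rule: linorder_cases)
     (auto simp: left_trace_def simp del: flux.simps char_speed.simps)

lemma right_trace_iff:
  "right_trace k b r \<longleftrightarrow> b \<in> {0..\<rho>j - k} \<and> (b = r \<or> b < r \<and> Q k b \<le> Q k r \<or> r < b \<and> b \<le> \<gamma> k)"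
  using shock_speed_sign(2)[OF k, of b r] \<Lambda>_sign(4)[OF k, of b]
  by (cases b r rule: linorder_cases)
     (auto simp: right_trace_def simp del: flux.simps char_speed.simps)

lemma demand_le_capacity: "partial_demand k r \<le> Q k (\<gamma> k)"
  using Q_le_Q\<gamma>[OF k, of r] r by (simp add: demand_eq k del: flux.simps)

lemma demand_nonneg: "0 \<le> partial_demand k r"
  using Q_nonneg[OF k, of r] Q_nonneg[OF k \<gamma>_range[OF k]] r
  by (simp add: demand_eq k del: flux.simps)

text \<open>An upstream trace carries at most the demand, and an undercritical one is the upstream state itself,
  carrying exactly the demand: to reach another state below \<open>\<gamma> k\<close> a wave of positive speed would be
  needed. The supply plays the same part downstream.\<close>

lemma left_trace_cases:
  assumes "left_trace k r a"
  shows "Q k a \<le> partial_demand k r" "\<gamma> k \<le> a \<or> a = r \<and> r < \<gamma> k \<and> Q k a = partial_demand k r"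
proof -
  have a: "a \<in> {0..\<rho>j - k}" "a = r \<or> r < a \<and> Q k a \<le> Q k r \<or> \<gamma> k \<le> a \<and> a < r"
    using assms left_trace_iff by blast+
  show "Q k a \<le> partial_demand k r"
    using a Q_le_Q\<gamma>[OF k, of a] by (auto simp: demand_eq k simp del: flux.simps)
  show "\<gamma> k \<le> a \<or> a = r \<and> r < \<gamma> k \<and> Q k a = partial_demand k r"
    using a r Q_increasing[OF k, of r a] by (force simp: demand_eq k simp del: flux.simps)
qed

lemma right_trace_cases:
  assumes "right_trace k b r"
  shows "Q k b \<le> partial_supply k r" "b \<le> \<gamma> k \<or> b = r \<and> \<gamma> k < r \<and> Q k b = partial_supply k r"
proof -
  have b: "b \<in> {0..\<rho>j - k}" "b = r \<or> b < r \<and> Q k b \<le> Q k r \<or> r < b \<and> b \<le> \<gamma> k"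
    using assms right_trace_iff by blast+
  show "Q k b \<le> partial_supply k r"
    using b Q_le_Q\<gamma>[OF k, of b] by (auto simp: supply_eq k simp del: flux.simps)
  show "b \<le> \<gamma> k \<or> b = r \<and> \<gamma> k < r \<and> Q k b = partial_supply k r"
    using b r Q_decreasing[OF k, of b r] by (force simp: supply_eq k simp del: flux.simps)
qed

lemma left_trace_over:
  assumes "a \<in> {\<gamma> k..\<rho>j - k}" "Q k a \<le> partial_demand k r"
  shows "left_trace k r a"
  using assms r \<gamma>_range[OF k] Q_decreasing[OF k, of r a] unfolding left_trace_iff demand_eq[OF k]
  by (cases r a rule: linorder_cases; cases "r < \<gamma> k") (auto simp del: flux.simps)

lemma right_trace_under:
  assumes "b \<in> {0..\<gamma> k}" "Q k b \<le> partial_supply k r"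
  shows "right_trace k b r"
  using assms r \<gamma>_range[OF k] Q_increasing[OF k, of b r] unfolding right_trace_iff supply_eq[OF k]
  by (cases r b rule: linorder_cases; cases "\<gamma> k < r") (auto simp del: flux.simps)

text \<open>Different traces with the same flux lie on different sides of \<open>\<gamma> k\<close>. One of them is then the outer
  state, and it is separated from the other by a shock resting at the origin, which is invisible
  in \<open>\<xi> < 0\<close>.\<close>

lemma left_profile_unique:
  assumes "left_trace k r a" "left_trace k r a'" "Q k a = Q k a'" "\<xi> < 0"
  shows "profile V \<rho>j (k, r) (link k r a) \<xi> = profile V \<rho>j (k, r) (link k r a') \<xi>"
proof -
  have still: "profile V \<rho>j (k, r) (link k r b) \<xi> = (k, r)" if "r < b" "Q k b = Q k r" for b
    using that \<open>\<xi> < 0\<close> by (simp add: shock_speed_def del: flux.simps)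
  have "a \<in> {0..\<rho>j - k}" "a' \<in> {0..\<rho>j - k}"
    using assms left_trace_iff by blast+
  then consider "a = a'" | "a = r" "r < a'" | "a' = r" "r < a"
    using Q_inj_over[OF k, of a a'] assms left_trace_cases(2)[of a] left_trace_cases(2)[of a']
    by force
  then show ?thesis
    by cases (use assms still in \<open>simp_all del: flux.simps\<close>)
qed

lemma right_profile_unique:
  assumes "right_trace k b r" "right_trace k b' r" "Q k b = Q k b'" "0 \<le> \<xi>"
  shows "profile V \<rho>j (k, b) (link k b r) \<xi> = profile V \<rho>j (k, b') (link k b' r) \<xi>"
proof -
  have still: "profile V \<rho>j (k, c) (link k c r) \<xi> = (k, r)" if "c < r" "Q k c = Q k r" for c
    using that \<open>0 \<le> \<xi>\<close> by (simp add: shock_speed_def del: flux.simps)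
  have "b \<in> {0..\<rho>j - k}" "b' \<in> {0..\<rho>j - k}"
    using assms right_trace_iff by blast+
  then consider "b = b'" | "b = r" "b' < r" | "b' = r" "b < r"
    using Q_inj_under[OF k, of b b'] assms right_trace_cases(2)[of b] right_trace_cases(2)[of b']
    by force
  then show ?thesis
    by cases (use assms still in \<open>simp_all del: flux.simps\<close>)
qed

text \<open>If the last wave has speed exactly zero, the trace itself need not be the limit of the solution; for
  a resting shock the limit is the outer state, which has the same flux.\<close>

lemma left_flux_limit:
  assumes "left_trace k r a"
  shows "((\<lambda>\<xi>. flux V (profile V \<rho>j (k, r) (link k r a) \<xi>)) \<longlongrightarrow> Q k a) (at_left 0)"
proof (cases r a rule: linorder_cases)
  case less
  let ?s = "shock_speed V (k, r) (k, a)"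
  have "?s \<le> 0" using assms less by (auto simp: left_trace_def)
  show ?thesis
  proof (cases "?s = 0")
    case True
    then have "Q k r = Q k a" using less by (simp add: shock_speed_def del: flux.simps)
    then show ?thesis
      using True less
      by (intro tendsto_eventually eventually_at_leftI[of "-1"]) (auto simp del: flux.simps)
  next
    case False
    then show ?thesis
      using \<open>?s \<le> 0\<close> less
      by (intro tendsto_eventually eventually_at_leftI[of ?s]) (auto simp del: flux.simps)
  qed
next
  case equal
  then show ?thesis by (auto simp del: flux.simps)
next
  case greater
  have a: "0 \<le> a" "\<Lambda> k a \<le> 0" "\<Lambda> k r < \<Lambda> k a"
    using assms greater \<Lambda>_strict_decreasing[OF k, of a r] r
    by (auto simp: left_trace_def simp del: char_speed.simps)
  show ?thesis
  proof (cases "\<Lambda> k a = 0")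
    case True
    let ?p = "profile V \<rho>j (k, r) [Rarefaction (k, r) (k, a)]"
    have "((\<lambda>\<xi>. flux V (?p \<xi>)) \<longlongrightarrow> flux V (?p 0)) (at 0 within {\<Lambda> k r..\<Lambda> k a})"
      using rarefaction_flux_continuous[OF k, of a r] a r greater True
      by (auto simp: continuous_on_def simp del: char_speed.simps profile.simps)
    moreover have "at 0 within {\<Lambda> k r..\<Lambda> k a} = at_left 0"
      using a True by (simp add: at_within_Icc_at_left del: char_speed.simps)
    moreover have "?p 0 = (k, a)"
      using True rarefaction_profile[OF k, of a r a] a greater r
      by (simp del: char_speed.simps profile.simps)
    ultimately show ?thesis
      using greater by (simp del: char_speed.simps profile.simps flux.simps)
  next
    case False
    then show ?thesis
      using a greater
      by (intro tendsto_eventually eventually_at_leftI[of "\<Lambda> k a"])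
         (auto simp del: flux.simps char_speed.simps)
  qed
qed

lemma right_flux_limit:
  assumes "right_trace k b r"
  shows "((\<lambda>\<xi>. flux V (profile V \<rho>j (k, b) (link k b r) \<xi>)) \<longlongrightarrow> Q k b) (at_right 0)"
proof (cases b r rule: linorder_cases)
  case less
  let ?s = "shock_speed V (k, b) (k, r)"
  have "0 \<le> ?s" using assms less by (auto simp: right_trace_def)
  show ?thesis
  proof (cases "?s = 0")
    case True
    then have "Q k r = Q k b" using less by (simp add: shock_speed_def del: flux.simps)
    then show ?thesis
      using True less
      by (intro tendsto_eventually eventually_at_rightI[of _ 1]) (auto simp del: flux.simps)
  next
    case False
    then show ?thesis
      using \<open>0 \<le> ?s\<close> less
      by (intro tendsto_eventually eventually_at_rightI[of _ ?s]) (auto simp del: flux.simps)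
  qed
next
  case equal
  then show ?thesis by (auto simp del: flux.simps)
next
  case greater
  have b: "b \<le> \<rho>j - k" "0 \<le> \<Lambda> k b" "\<Lambda> k b < \<Lambda> k r"
    using assms greater \<Lambda>_strict_decreasing[OF k, of r b] r
    by (auto simp: right_trace_def simp del: char_speed.simps)
  show ?thesis
  proof (cases "\<Lambda> k b = 0")
    case True
    let ?p = "profile V \<rho>j (k, b) [Rarefaction (k, b) (k, r)]"
    have "((\<lambda>\<xi>. flux V (?p \<xi>)) \<longlongrightarrow> flux V (?p 0)) (at 0 within {\<Lambda> k b..\<Lambda> k r})"
      using rarefaction_flux_continuous[OF k, of r b] b r greater True
      by (auto simp: continuous_on_def simp del: char_speed.simps profile.simps)
    moreover have "at 0 within {\<Lambda> k b..\<Lambda> k r} = at_right 0"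
      using b True by (simp add: at_within_Icc_at_right del: char_speed.simps)
    moreover have "?p 0 = (k, b)"
      using True rarefaction_profile[OF k, of r b b] b greater r
      by (simp del: char_speed.simps profile.simps)
    ultimately show ?thesis
      using greater by (simp del: char_speed.simps profile.simps flux.simps)
  next
    case False
    then show ?thesis
      using b greater
      by (intro tendsto_eventually eventually_at_rightI[of _ "\<Lambda> k b"])
         (auto simp del: flux.simps char_speed.simps)
  qed
qed

end

section \<open>Stacks of waves of zero speed\<close>

lemma zero_speed_wave:
  assumes "proper w" "min_speed V \<rho>j w = 0" "max_speed V \<rho>j w = 0"
  shows "flux V (rstate w) = flux V (lstate w)"
    "is_Standing w \<or> fst (rstate w) = fst (lstate w) \<and> snd (lstate w) < snd (rstate w)"
  using assms rarefaction_min_less_max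
  by (cases w; force simp: proper_def shock_speed_def)+

text \<open>A stack of standing waves and resting shocks conserves the flux. Below the capacity at \<open>k\<close>, and
  hence below that at \<open>0\<close>, no state of the stack is critical; so the Isaacson-Temple condition applies
  to every standing wave in turn, and resting shocks only increase the density. The stack cannot leave
  the overcritical side.\<close>

lemma zero_speed_stack:
  assumes "joins U Z W" and k: "0 \<le> k" "k \<le> \<rho>j"
    and "\<And>w. w \<in> set Z \<Longrightarrow> proper w \<and> isaacson_temple V \<rho>j w \<and> min_speed V \<rho>j w = 0 \<and>
      max_speed V \<rho>j w = 0 \<and> {fst (lstate w), fst (rstate w)} \<subseteq> {k, 0}"
  shows "flux V W = flux V U \<and>
    (overcritical V \<rho>j U \<and> flux V U < Q k (\<gamma> k) \<longrightarrow> overcritical V \<rho>j W)"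
  using assms(1,4)
proof (induction Z arbitrary: U)
  case Nil
  then show ?case by simp
next
  case (Cons w Z)
  obtain l x r y where U: "lstate w = (l, x)" "rstate w = (r, y)" "U = (l, x)"
    using Cons.prems(1) by (metis joins.simps(2) surj_pair)
  have w: "proper w" "isaacson_temple V \<rho>j w" "{l, r} \<subseteq> {k, 0}"
      "min_speed V \<rho>j w = 0" "max_speed V \<rho>j w = 0"
    using Cons.prems(2)[of w] U by auto
  note eq = zero_speed_wave[OF w(1,4,5), unfolded U fst_conv snd_conv]
  have IH: "flux V W = flux V (r, y) \<and>
    (overcritical V \<rho>j (r, y) \<and> flux V (r, y) < Q k (\<gamma> k) \<longrightarrow> overcritical V \<rho>j W)"
    using Cons.prems U by (intro Cons.IH) auto
  have "\<gamma> r < y" if over: "\<gamma> l < x" "Q l x < Q k (\<gamma> k)"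
  proof (cases "is_Standing w")
    case True
    then have "\<not> y < \<gamma> r" using w(2) U over by (cases w) auto
    moreover have "Q k (\<gamma> k) \<le> Q 0 (\<gamma> 0)"
      using capacity_decreasing[of k] k by (cases "k = 0") (auto simp del: flux.simps)
    then have "Q l x < Q r (\<gamma> r)" using over w(3) by (auto simp del: flux.simps)
    then have "y \<noteq> \<gamma> r" using eq(1) by (metis less_irrefl)
    ultimately show ?thesis by simp
  next
    case False
    then show ?thesis using eq(2) over by auto
  qed
  then show ?case
    using IH eq(1) U by (auto simp del: flux.simps)
qed

section \<open>Wave solutions and their traces\<close>

text \<open>The last clause is what remains of the Isaacson-Temple condition when the waves at the origin
  are forgotten. An undercritical \<open>a\<close> with an overcritical \<open>b\<close> is not excluded: a resting shock can
  make this transition.\<close>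

definition traces :: "real \<Rightarrow> real \<Rightarrow> real \<Rightarrow> real \<Rightarrow> real \<Rightarrow> bool" where
  "traces k r a b s \<longleftrightarrow>
     left_trace k r a \<and> right_trace 0 b s \<and> Q k a = Q 0 b \<and> \<not> (\<gamma> k < a \<and> b < \<gamma> 0)"

definition glued_profile :: "real \<Rightarrow> real \<Rightarrow> real \<Rightarrow> real \<Rightarrow> real \<Rightarrow> real \<Rightarrow> state" where
  "glued_profile k r a b s \<xi> =
     (if \<xi> < 0 then profile V \<rho>j (k, r) (link k r a) \<xi> else profile V \<rho>j (0, b) (link 0 b s) \<xi>)"

text \<open>The filter drops the standing wave if its two states agree, which can happen only for \<open>k = 0\<close>.\<close>

definition wave_list :: "real \<Rightarrow> real \<Rightarrow> real \<Rightarrow> real \<Rightarrow> real \<Rightarrow> wave list" where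
  "wave_list k r a b s =
     link k r a @ filter (\<lambda>w. lstate w \<noteq> rstate w) [Standing (k, a) (0, b)] @ link 0 b s"

text \<open>The part of being a wave solution that concerns the list of waves alone.\<close>

definition connects :: "state \<Rightarrow> state \<Rightarrow> wave list \<Rightarrow> bool" where
  "connects U W ws \<longleftrightarrow> joins U ws W \<and> lax V \<rho>j ws \<and>
     (\<forall>w\<in>set ws. proper w \<and> isaacson_temple V \<rho>j w \<and>
        {fst (lstate w), fst (rstate w)} \<subseteq> {fst U, fst W})"

lemma solves_with_waves_iff:
  "solves_with_waves V \<rho>j UL UR ws u \<longleftrightarrow> connects UL UR ws \<and>
     (\<forall>x<0. u x 0 = UL) \<and> (\<forall>x>0. u x 0 = UR) \<and>
     (\<forall>x. \<forall>t>0. u x t = profile V \<rho>j UL ws (x / t))"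
  by (auto simp: solves_with_waves_def connects_def proper_def)

context
  fixes k r s :: real
  assumes k: "0 \<le> k" "k \<le> \<rho>j" and r: "r \<in> {0..\<rho>j - k}" and s: "s \<in> {0..\<rho>j}"
begin

lemma range_0: "(0::real) \<le> 0" "0 \<le> \<rho>j" "s \<in> {0..\<rho>j - 0}"
  using s by auto

lemma capacity_le: "Q k (\<gamma> k) \<le> Q 0 (\<gamma> 0)"
  using capacity_decreasing[of k] k by (cases "k = 0") (auto simp del: flux.simps)

text \<open>If the flux is below the demand, the upstream trace is strictly overcritical. The Isaacson-Temple
  clause then forbids an undercritical downstream trace, and a critical one would carry the capacity at
  \<open>0\<close>, which is too much. So the downstream trace is overcritical and carries the whole supply.\<close>

lemma traces_flux:
  assumes "traces k r a b s"
  shows "Q k a = min (partial_supply 0 s) (partial_demand k r)"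
proof -
  have t: "left_trace k r a" "right_trace 0 b s" "Q k a = Q 0 b" "\<not> (\<gamma> k < a \<and> b < \<gamma> 0)"
    using assms by (auto simp: traces_def simp del: flux.simps)
  note left = left_trace_cases[OF k r t(1)] and right = right_trace_cases[OF range_0 t(2)]
  have "Q k a = partial_supply 0 s" if less: "Q k a < partial_demand k r"
  proof -
    have "Q k a < Q k (\<gamma> k)"
      using less demand_le_capacity[OF k r] by simp
    then have "a \<noteq> \<gamma> k" "b \<noteq> \<gamma> 0"
      using capacity_le t(3) by (metis less_irrefl, metis not_less)
    then have "\<gamma> k < a" using left(2) less by auto
    with \<open>b \<noteq> \<gamma> 0\<close> have "\<gamma> 0 < b" using t(4) by auto
    then show ?thesis using right(2) t(3) by auto
  qed
  then show ?thesis using left(1) right(1) t(3) by linarith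
qed

lemma glued_profile_unique:
  assumes "traces k r a b s" "traces k r a' b' s"
  shows "glued_profile k r a b s = glued_profile k r a' b' s"
proof
  fix \<xi>
  have eq: "Q k a = Q k a'" "Q 0 b = Q 0 b'"
    using assms traces_flux[of a b] traces_flux[of a' b'] by (simp_all add: traces_def)
  show "glued_profile k r a b s \<xi> = glued_profile k r a' b' s \<xi>"
    unfolding glued_profile_def
    using assms left_profile_unique[OF k r _ _ eq(1)] right_profile_unique[OF range_0 _ _ eq(2)]
    by (auto simp: traces_def simp del: flux.simps)
qed

text \<open>For \<open>k > 0\<close> there is a standing wave, since \<open>k\<close> has to drop to \<open>0\<close>. The waves before the first one
  have speeds \<open>\<le> 0\<close> and keep \<open>k\<close>, those after the last one have speeds \<open>\<ge> 0\<close> and keep \<open>0\<close>, and those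
  in between form a stack of zero speed.\<close>

lemma connects_glued_profile:
  assumes "0 < k" and ws: "connects (k, r) (0, s) ws"
  obtains a b where "traces k r a b s" "profile V \<rho>j (k, r) ws = glued_profile k r a b s"
proof -
  have joins: "joins (k, r) ws (0, s)" and lax: "lax V \<rho>j ws"
    and wave: "\<And>w. w \<in> set ws \<Longrightarrow> proper w \<and> isaacson_temple V \<rho>j w \<and>
      {fst (lstate w), fst (rstate w)} \<subseteq> {k, 0}"
    using ws by (auto simp: connects_def)
  have kr: "(k, r) \<in> phase_space \<rho>j" using k r by (simp add: phase_space_iff)
  have "\<exists>w\<in>set ws. is_Standing w"
    using nonstanding_waves[OF _ lax joins kr] wave \<open>0 < k\<close> by fastforce
  then obtain A Z P where split: "ws = A @ Z @ P" "Z \<noteq> []" "is_Standing (hd Z)" "is_Standing (last Z)"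
    "\<forall>w\<in>set A. \<not> is_Standing w" "\<forall>w\<in>set P. \<not> is_Standing w"
    using split_at_extreme_occurrences[of ws is_Standing] by metis
  have minmax: "\<And>w. w \<in> set ws \<Longrightarrow> min_speed V \<rho>j w \<le> max_speed V \<rho>j w"
    using wave min_le_max_speed by blast
  have standing: "is_Standing w \<Longrightarrow> min_speed V \<rho>j w = 0 \<and> max_speed V \<rho>j w = 0" for w
    by (cases w) auto
  have sorted: "sorted_wrt (\<lambda>w w'. max_speed V \<rho>j w \<le> min_speed V \<rho>j w') (A @ Z @ P)"
    using lax_sorted[OF lax] wave split(1) by blast
  have A0: "max_speed V \<rho>j w \<le> 0" if "w \<in> set A" for w
  proof -
    have "max_speed V \<rho>j w \<le> min_speed V \<rho>j (hd Z)"
      using sorted that hd_in_set[OF split(2)] by (auto simp: sorted_wrt_append)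
    then show ?thesis using standing[OF split(3)] by simp
  qed
  have P0: "0 \<le> min_speed V \<rho>j w" if "w \<in> set P" for w
  proof -
    have "max_speed V \<rho>j (last Z) \<le> min_speed V \<rho>j w"
      using sorted that last_in_set[OF split(2)] by (auto simp: sorted_wrt_append)
    then show ?thesis using standing[OF split(4)] by simp
  qed
  have Z_min: "0 \<le> min_speed V \<rho>j w" if "w \<in> set Z" for w
  proof (cases Z)
    case (Cons z Z')
    then show ?thesis
      using sorted that split(3) standing by (auto simp: sorted_wrt_append)
  qed (use that in simp)
  have Z_max: "max_speed V \<rho>j w \<le> 0" if "w \<in> set Z" for w
  proof (cases Z rule: rev_cases)
    case (snoc Z' z)
    then show ?thesis
      using sorted that split(4) standing by (auto simp: sorted_wrt_append)
  qed (use that in simp)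
  have Z0: "min_speed V \<rho>j w = 0 \<and> max_speed V \<rho>j w = 0" if "w \<in> set Z" for w
    using Z_min[OF that] Z_max[OF that] minmax[of w] that split(1) by auto

  obtain M1 M2 where M: "joins (k, r) A M1" "joins M1 Z M2" "joins M2 P (0, s)"
    using joins split(1) by (auto simp: joins_append)
  have laxA: "lax V \<rho>j A" and laxP: "lax V \<rho>j P"
    using lax split(1) by (auto simp: lax_def successively_append_iff)
  obtain k1 a k2 b where M12: "M1 = (k1, a)" "M2 = (k2, b)" by fastforce
  have "M2 = rstate (last Z)"
    using M(2) split(2) by (induction Z arbitrary: M1) (auto split: if_splits)
  then have M2: "M2 \<in> phase_space \<rho>j"
    using wave[of "last Z"] split(1,2) last_in_set[of Z] by (simp add: proper_def)

  have cA: "k1 = k \<and> (k, a) \<in> phase_space \<rho>j \<and>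
    profile V \<rho>j (k, r) A = profile V \<rho>j (k, r) (link k r a) \<and>
    (A = [] \<longleftrightarrow> link k r a = []) \<and>
    (A \<noteq> [] \<longrightarrow> min_speed V \<rho>j (hd A) = min_speed V \<rho>j (hd (link k r a)) \<and>
      max_speed V \<rho>j (last A) = max_speed V \<rho>j (last (link k r a)))"
    using M(1) M12 split laxA wave kr by (intro nonstanding_waves) auto
  have cP: "0 = k2 \<and> (k2, s) \<in> phase_space \<rho>j \<and>
    profile V \<rho>j (k2, b) P = profile V \<rho>j (k2, b) (link k2 b s) \<and>
    (P = [] \<longleftrightarrow> link k2 b s = []) \<and>
    (P \<noteq> [] \<longrightarrow> min_speed V \<rho>j (hd P) = min_speed V \<rho>j (hd (link k2 b s)) \<and>
      max_speed V \<rho>j (last P) = max_speed V \<rho>j (last (link k2 b s)))"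
    using M(3) M12 split laxP wave M2 by (intro nonstanding_waves) auto

  have k2: "k2 = 0" using cP by simp
  have P_eq: "profile V \<rho>j (0, b) P = profile V \<rho>j (0, b) (link 0 b s)"
    using cP unfolding k2 by blast
  have left: "left_trace k r a"
    using cA A0[OF last_in_set[of A]] unfolding left_trace_def phase_space_iff
    by (cases r a rule: linorder_cases) auto
  have right: "right_trace 0 b s"
    using cP P0[OF hd_in_set[of P]] M2 M12 unfolding right_trace_def
    by (cases b s rule: linorder_cases) (auto simp: phase_space_iff)
  have stack: "Q 0 b = Q k a \<and> (\<gamma> k < a \<and> Q k a < Q k (\<gamma> k) \<longrightarrow> \<gamma> 0 < b)"
    using zero_speed_stack[OF M(2) k] Z0 wave split(1) cA cP M12 by (auto simp del: flux.simps)
  have "\<not> (\<gamma> k < a \<and> b < \<gamma> 0)"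
    using stack Q_less_capacity[OF k, of a] left unfolding left_trace_def by auto
  with left right stack have "traces k r a b s"
    by (simp add: traces_def del: flux.simps)
  moreover have "profile V \<rho>j (k, r) ws = glued_profile k r a b s"
  proof
    fix \<xi>
    show "profile V \<rho>j (k, r) ws \<xi> = glued_profile k r a b s \<xi>"
    proof (cases "\<xi> < 0")
      case True
      have "profile V \<rho>j (k, r) ws \<xi> = profile V \<rho>j (k, r) A \<xi>"
        unfolding split(1) by (rule profile_ahead[OF M(1)]) (use True Z_min P0 in force)
      then show ?thesis using True cA by (simp add: glued_profile_def)
    next
      case False
      have "joins (k, r) (A @ Z) M2" unfolding joins_append using M by blast
      then have "profile V \<rho>j (k, r) ((A @ Z) @ P) \<xi> = profile V \<rho>j M2 P \<xi>"
      proof (rule profile_behind)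
        fix w assume "w \<in> set (A @ Z)"
        then show "min_speed V \<rho>j w \<le> \<xi> \<and> max_speed V \<rho>j w \<le> \<xi>"
          using A0[of w] Z_max[of w] minmax[of w] False split(1) by auto
      qed
      then show ?thesis
        using False P_eq split(1) M12 k2 by (simp add: glued_profile_def)
    qed
  qed
  ultimately show ?thesis using that by blast
qed

text \<open>For \<open>k = 0\<close> a standing wave would join different states with equal flux, one on each side of \<open>\<gamma> 0\<close>,
  against the Isaacson-Temple condition.\<close>

lemma connects_same_k:
  assumes "k = 0" and ws: "connects (k, r) (0, s) ws"
  shows "profile V \<rho>j (k, r) ws = profile V \<rho>j (k, r) (link k r s)"
proof -
  have "\<not> is_Standing w" if "w \<in> set ws" for w
  proof
    assume "is_Standing w"
    then obtain k1 k2 x y where std: "w = Standing (k1, x) (k2, y)"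
      by (cases w) auto
    have "proper w \<and> isaacson_temple V \<rho>j w \<and> {fst (lstate w), fst (rstate w)} \<subseteq> {0}"
      using ws that \<open>k = 0\<close> by (force simp: connects_def)
    then have w: "w = Standing (0, x) (0, y)" "isaacson_temple V \<rho>j w"
      "x \<noteq> y" "Q 0 x = Q 0 y" "x \<in> {0..\<rho>j - 0}" "y \<in> {0..\<rho>j - 0}"
      using std by (auto simp: proper_def phase_space_iff)
    then show False
      using Q_inj_under[OF range_0(1,2), of x y] Q_inj_over[OF range_0(1,2), of x y]
      by (cases "x \<le> \<gamma> 0"; cases "y \<le> \<gamma> 0") (auto simp: not_less not_le)
  qed
  then show ?thesis
    using nonstanding_waves[of ws k r 0 s] ws k r by (auto simp: connects_def phase_space_iff)
qed

text \<open>Traces on the same weak side can be joined by a single standing wave.\<close>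

lemma wave_list_connects:
  assumes t: "left_trace k r a" "right_trace 0 b s" "Q k a = Q 0 b"
    and side: "a \<le> \<gamma> k \<and> b \<le> \<gamma> 0 \<or> \<gamma> k \<le> a \<and> \<gamma> 0 \<le> b"
  shows "connects (k, r) (0, s) (wave_list k r a b s)"
    and "profile V \<rho>j (k, r) (wave_list k r a b s) = glued_profile k r a b s"
proof -
  let ?st = "filter (\<lambda>w. lstate w \<noteq> rstate w) [Standing (k, a) (0, b)]"
  have phase: "(k, r) \<in> phase_space \<rho>j" "(k, a) \<in> phase_space \<rho>j"
    "(0, b) \<in> phase_space \<rho>j" "(0, s) \<in> phase_space \<rho>j"
    using t k r range_0 by (auto simp: phase_space_iff left_trace_def right_trace_def)
  have left: "max_speed V \<rho>j w \<le> 0" "min_speed V \<rho>j w \<le> 0" if "w \<in> set (link k r a)" for w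
    using t(1) min_le_max_speed[OF link_waves(1)[OF phase(1,2) that]] that
    by (force simp: left_trace_def)+
  have right: "0 \<le> min_speed V \<rho>j w" if "w \<in> set (link 0 b s)" for w
    using t(2) that by (force simp: right_trace_def)
  have st: "joins (k, a) ?st (0, b)" by auto
  have stw: "w = Standing (k, a) (0, b) \<and> (k, a) \<noteq> (0, b)" if "w \<in> set ?st" for w
    using that by (auto split: if_splits)
  show "connects (k, r) (0, s) (wave_list k r a b s)"
    unfolding connects_def
  proof (intro conjI ballI)
    show "joins (k, r) (wave_list k r a b s) (0, s)"
      unfolding wave_list_def joins_append
      using joins_link[of k r a] joins_link[of 0 b s] st by blast
    have ends: "link k r a \<noteq> [] \<Longrightarrow> max_speed V \<rho>j (last (link k r a)) \<le> 0"
      "link 0 b s \<noteq> [] \<Longrightarrow> 0 \<le> min_speed V \<rho>j (hd (link 0 b s))"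
      using left right by auto
    have single: "successively R (link k x y)" for R k x y by (auto simp: link_def)
    show "lax V \<rho>j (wave_list k r a b s)"
      unfolding lax_def wave_list_def successively_append_iff
      using ends single by (auto intro: order_trans)
    fix w assume "w \<in> set (wave_list k r a b s)"
    then consider "w \<in> set (link k r a)" | "w \<in> set ?st" | "w \<in> set (link 0 b s)"
      by (auto simp: wave_list_def)
    then have "proper w \<and> isaacson_temple V \<rho>j w \<and>
        {fst (lstate w), fst (rstate w)} \<subseteq> {fst (k, r), fst (0, s)}"
    proof cases
      case 1
      then show ?thesis using link_waves[OF phase(1,2)] by auto
    next
      case 2
      then show ?thesis using stw[OF 2] t(3) side phase by (auto simp: proper_def simp del: flux.simps)
    next
      case 3
      then show ?thesis using link_waves[OF phase(3,4)] by auto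
    qed
    then show "proper w" "isaacson_temple V \<rho>j w"
      "{fst (lstate w), fst (rstate w)} \<subseteq> {fst (k, r), fst (0, s)}" by blast+
  qed
  show "profile V \<rho>j (k, r) (wave_list k r a b s) = glued_profile k r a b s"
  proof
    fix \<xi>
    show "profile V \<rho>j (k, r) (wave_list k r a b s) \<xi> = glued_profile k r a b s \<xi>"
    proof (cases "\<xi> < 0")
      case True
      then show ?thesis
        unfolding wave_list_def glued_profile_def
        by (subst profile_ahead[OF joins_link]) (use right stw in \<open>force+\<close>)
    next
      case False
      have "joins (k, r) (link k r a @ ?st) (0, b)"
        unfolding joins_append using joins_link[of k r a] st by blast
      then have "profile V \<rho>j (k, r) ((link k r a @ ?st) @ link 0 b s) \<xi> =
          profile V \<rho>j (0, b) (link 0 b s) \<xi>"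
      proof (rule profile_behind)
        fix w assume "w \<in> set (link k r a @ ?st)"
        then show "min_speed V \<rho>j w \<le> \<xi> \<and> max_speed V \<rho>j w \<le> \<xi>"
          using left[of w] stw[of w] False by fastforce
      qed
      then show ?thesis using False by (simp add: wave_list_def glued_profile_def)
    qed
  qed
qed

lemma glued_profile_flux_limit:
  assumes "left_trace k r a" "right_trace 0 b s" "Q k a = Q 0 b"
  shows "((\<lambda>\<xi>. flux V (glued_profile k r a b s \<xi>)) \<longlongrightarrow> Q k a) (at 0)"
proof (rule filterlim_split_at)
  show "((\<lambda>\<xi>. flux V (glued_profile k r a b s \<xi>)) \<longlongrightarrow> Q k a) (at_left 0)"
    by (rule Lim_transform_eventually[OF left_flux_limit[OF k r assms(1)]])
       (auto simp: glued_profile_def intro!: eventually_at_leftI[of "-1"])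
  show "((\<lambda>\<xi>. flux V (glued_profile k r a b s \<xi>)) \<longlongrightarrow> Q k a) (at_right 0)"
    unfolding assms(3)
    by (rule Lim_transform_eventually[OF right_flux_limit[OF range_0 assms(2)]])
       (auto simp: glued_profile_def intro!: eventually_at_rightI[of _ 1])
qed

text \<open>To identify any given wave solution it is enough to exhibit traces with equal flux on
  the same weak side.\<close>

lemma wave_solution_by_traces:
  assumes t: "left_trace k r a" "right_trace 0 b s" "Q k a = Q 0 b"
    and side: "a \<le> \<gamma> k \<and> b \<le> \<gamma> 0 \<or> \<gamma> k \<le> a \<and> \<gamma> 0 \<le> b"
    and u: "wave_solution V \<rho>j (k, r) (0, s) u"
  shows "solves_with_waves V \<rho>j (k, r) (0, s) (wave_list k r a b s) u"
    and "boundary_flux V u (Q k a)"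
proof -
  obtain ws where ws: "solves_with_waves V \<rho>j (k, r) (0, s) ws u"
    using u by (auto simp: wave_solution_def)
  then have c: "connects (k, r) (0, s) ws" by (simp add: solves_with_waves_iff)
  note canon = wave_list_connects[OF t side]
  have eq: "profile V \<rho>j (k, r) ws = glued_profile k r a b s"
  proof (cases "k = 0")
    case True
    then show ?thesis using connects_same_k[OF True] c canon by metis
  next
    case False
    with k have "0 < k" by simp
    then obtain a' b' where "traces k r a' b' s" "profile V \<rho>j (k, r) ws = glued_profile k r a' b' s"
      using connects_glued_profile c by metis
    moreover have "traces k r a b s"
      using t side by (auto simp: traces_def simp del: flux.simps)
    ultimately show ?thesis using glued_profile_unique by metis
  qed
  show "solves_with_waves V \<rho>j (k, r) (0, s) (wave_list k r a b s) u"
    using ws canon eq by (simp add: solves_with_waves_iff)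
  show "boundary_flux V u (Q k a)"
    unfolding boundary_flux_def
  proof (intro allI impI)
    fix t :: real assume "0 < t"
    have "filterlim (\<lambda>x. x / t) (at 0) (at 0)"
      unfolding filterlim_at
      using \<open>0 < t\<close> by (auto intro!: tendsto_eq_intros simp: eventually_at_filter)
    from filterlim_compose[OF glued_profile_flux_limit[OF t] this]
    show "((\<lambda>x. flux V (u x t)) \<longlongrightarrow> Q k a) (at 0)"
      using ws eq \<open>0 < t\<close> by (simp add: solves_with_waves_iff del: flux.simps)
  qed
qed

text \<open>If the demand is the smaller of the two, it is sent from the state on the undercritical side that
  realizes it and received in the state on the undercritical side with that flux; otherwise the downstream
  state is overcritical and imposes its flux on an overcritical upstream trace.\<close>

lemma traces_exist:
  obtains a b where "left_trace k r a" "right_trace 0 b s" "Q k a = Q 0 b"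
    "a \<le> \<gamma> k \<and> b \<le> \<gamma> 0 \<or> \<gamma> k \<le> a \<and> \<gamma> 0 \<le> b"
proof (cases "partial_demand k r \<le> partial_supply 0 s")
  case True
  define a where "a = min r (\<gamma> k)"
  have a: "Q k a = partial_demand k r" "a \<le> \<gamma> k"
    by (auto simp: a_def demand_eq k min_def simp del: flux.simps)
  have "left_trace k r a"
    using r \<gamma>_range[OF k] by (auto simp: a_def left_trace_iff[OF k r] min_def)
  moreover obtain b where b: "b \<in> {0..\<gamma> 0}" "Q 0 b = partial_demand k r"
    using under_root[OF range_0(1,2), of "partial_demand k r"] demand_nonneg[OF k r]
      demand_le_capacity[OF k r] capacity_le by (metis order_trans)
  moreover have "right_trace 0 b s"
    using b True by (intro right_trace_under range_0) auto
  ultimately show ?thesis using a that by auto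
next
  case False
  then have "\<gamma> 0 < s" "Q 0 s < partial_demand k r"
    using demand_le_capacity[OF k r] capacity_le
    by (auto simp: supply_eq range_0 simp del: flux.simps split: if_splits)
  moreover obtain a where a: "a \<in> {\<gamma> k..\<rho>j - k}" "Q k a = Q 0 s"
    using over_root[OF k, of "Q 0 s"] calculation demand_le_capacity[OF k r] Q_nonneg[OF range_0]
    by (metis less_imp_le order_trans)
  moreover have "left_trace k r a"
    using a calculation by (intro left_trace_over k r) auto
  moreover have "right_trace 0 s s"
    using range_0 by (simp add: right_trace_def)
  ultimately show ?thesis using that by auto
qed

lemma wave_solution_exists: "\<exists>u. wave_solution V \<rho>j (k, r) (0, s) u"
proof -
  obtain a b where "left_trace k r a" "right_trace 0 b s" "Q k a = Q 0 b"
    "a \<le> \<gamma> k \<and> b \<le> \<gamma> 0 \<or> \<gamma> k \<le> a \<and> \<gamma> 0 \<le> b"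
    by (rule traces_exist)
  note c = wave_list_connects(1)[OF this]
  let ?ws = "wave_list k r a b s"
  let ?u = "\<lambda>x t. if t = 0 then if x < 0 then (k, r) else (0, s) else profile V \<rho>j (k, r) ?ws (x / t)"
  have "solves_with_waves V \<rho>j (k, r) (0, s) ?ws ?u"
    using c by (simp add: solves_with_waves_iff)
  then show ?thesis unfolding wave_solution_def by blast
qed

lemma boundary_flux_min:
  assumes "wave_solution V \<rho>j (k, r) (0, s) u"
  shows "boundary_flux V u (min (partial_supply 0 s) (partial_demand k r))"
proof -
  obtain a b where t: "left_trace k r a" "right_trace 0 b s" "Q k a = Q 0 b"
    "a \<le> \<gamma> k \<and> b \<le> \<gamma> 0 \<or> \<gamma> k \<le> a \<and> \<gamma> 0 \<le> b"
    by (rule traces_exist)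
  then have "Q k a = min (partial_supply 0 s) (partial_demand k r)"
    by (intro traces_flux[of a b]) (auto simp: traces_def simp del: flux.simps)
  then show ?thesis using wave_solution_by_traces(2)[OF t assms] by simp
qed

end

section \<open>Classification by the initial states\<close>

context
  fixes k r s :: real and u :: "real \<Rightarrow> real \<Rightarrow> state"
  assumes k: "0 \<le> k" "k \<le> \<rho>j" and r: "r \<in> {0..\<rho>j - k}" and s: "s \<in> {0..\<rho>j}"
    and u: "wave_solution V \<rho>j (k, r) (0, s) u"
begin

lemmas range_0' = range_0[OF k r s]

lemma flux_roots:
  assumes "0 \<le> f" "f \<le> Q 0 (\<gamma> 0)"
  obtains \<rho>1 \<rho>2 where "\<rho>1 \<in> {0..\<gamma> 0}" "\<rho>2 \<in> {\<gamma> 0..\<rho>j}" "Q 0 \<rho>1 = f" "Q 0 \<rho>2 = f"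
    "{\<rho>\<in>{0..\<rho>j}. Q 0 \<rho> = f} = {\<rho>1, \<rho>2}"
proof -
  obtain \<rho>1 where 1: "\<rho>1 \<in> {0..\<gamma> 0}" "Q 0 \<rho>1 = f"
    using under_root[OF range_0'(1,2) assms] by blast
  obtain \<rho>2 where 2: "\<rho>2 \<in> {\<gamma> 0..\<rho>j}" "Q 0 \<rho>2 = f"
    using over_root[OF range_0'(1,2) assms] by auto
  have "\<rho> = \<rho>1 \<or> \<rho> = \<rho>2" if "\<rho> \<in> {0..\<rho>j}" "Q 0 \<rho> = f" for \<rho>
    using that 1 2 Q_inj_under[OF range_0'(1,2), of \<rho> \<rho>1] Q_inj_over[OF range_0'(1,2), of \<rho> \<rho>2]
    by (cases "\<rho> \<le> \<gamma> 0") (auto simp del: flux.simps)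
  then have "{\<rho>\<in>{0..\<rho>j}. Q 0 \<rho> = f} = {\<rho>1, \<rho>2}"
    using 1 2 \<gamma>_range[OF range_0'(1,2)] by (auto simp del: flux.simps)
  then show ?thesis using that 1 2 by blast
qed

lemma over_root_set:
  assumes "0 \<le> k'" "k' \<le> \<rho>j" "\<rho>' \<in> {\<gamma> k'..\<rho>j - k'}" "Q k' \<rho>' = f"
  shows "{\<rho>\<in>{\<gamma> k'..\<rho>j - k'}. Q k' \<rho> = f} = {\<rho>'}"
  using assms Q_inj_over[OF assms(1,2) _ assms(3)] by (auto simp del: flux.simps)

text \<open>Here the flux is set upstream, and a wave with \<open>k = 0\<close> may leave the origin. The supply is at least
  that flux because the downstream state is not beyond \<open>\<rho>2\<close>; the alternative \<open>s \<le> \<rho>1\<close> is there for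
  \<open>\<rho>1 = \<rho>2\<close>.\<close>

lemma flux_limited_upstream:
  assumes a: "left_trace k r a" "a \<le> \<gamma> k"
    and b: "\<rho>1 \<in> {0..\<gamma> 0}" "\<rho>2 \<in> {\<gamma> 0..\<rho>j}" "Q 0 \<rho>1 = Q k a" "Q 0 \<rho>2 = Q k a"
    and s2: "s < \<rho>2 \<or> s \<le> \<rho>1"
  shows "solves_with_waves V \<rho>j (k, r) (0, s) (wave_list k r a \<rho>1 s) u \<and> boundary_flux V u (Q k a) \<and>
    (\<rho>1 < s \<longrightarrow> 0 < shock_speed V (0, \<rho>1) (0, s))"
proof -
  have le: "Q k a \<le> partial_supply 0 s"
    using Q_le_Q\<gamma>[OF range_0'(1,2), of \<rho>1] Q_decreasing[OF range_0'(1,2), of s \<rho>2] b s2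
      \<gamma>_range[OF range_0'(1,2)]
    by (auto simp: supply_eq range_0' simp del: flux.simps)
  have less: "Q 0 \<rho>1 < Q 0 s" if "\<rho>1 < s"
    using Q_increasing[OF range_0'(1,2), of \<rho>1 s] Q_decreasing[OF range_0'(1,2), of s \<rho>2] b s2 that
    by (cases "s \<le> \<gamma> 0") (auto simp del: flux.simps)
  have "right_trace 0 \<rho>1 s"
    using right_trace_under[OF range_0' b(1)] b(3) le by simp
  note sol = wave_solution_by_traces[OF k r s a(1) this b(3)[symmetric] disjI1 u]
  have "0 < shock_speed V (0, \<rho>1) (0, s)" if "\<rho>1 < s"
    using less[OF that] that by (simp add: shock_speed_def del: flux.simps)
  then show ?thesis using sol a b by auto
qed

text \<open>Here the congested downstream state sets the flux: it is itself the trace at the origin, and all moving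
  waves travel upstream.\<close>

lemma flux_limited_downstream:
  assumes "\<gamma> 0 \<le> s" "Q 0 s \<le> partial_demand k r"
  obtains \<rho>' where "\<rho>' \<in> {\<gamma> k..\<rho>j - k}" "Q k \<rho>' = Q 0 s"
    "{\<rho>\<in>{\<gamma> k..\<rho>j - k}. Q k \<rho> = Q 0 s} = {\<rho>'}"
    "solves_with_waves V \<rho>j (k, r) (0, s) (wave_list k r \<rho>' s s) u" "boundary_flux V u (Q 0 s)"
proof -
  obtain \<rho>' where \<rho>': "\<rho>' \<in> {\<gamma> k..\<rho>j - k}" "Q k \<rho>' = Q 0 s"
    using over_root[OF k, of "Q 0 s"] Q_nonneg[OF range_0'] assms(2) demand_le_capacity[OF k r]
    by (metis order_trans)
  have "left_trace k r \<rho>'"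
    using \<rho>' assms by (intro left_trace_over k r) auto
  moreover have "right_trace 0 s s"
    using range_0' by (simp add: right_trace_def)
  ultimately have "solves_with_waves V \<rho>j (k, r) (0, s) (wave_list k r \<rho>' s s) u"
    "boundary_flux V u (Q k \<rho>')"
    using wave_solution_by_traces[OF k r s _ _ \<rho>'(2) disjI2 u] \<rho>' assms by auto
  then show ?thesis
    using that \<rho>' over_root_set[OF k \<rho>'] by simp
qed

lemma undercritical_types:
  assumes "r < \<gamma> k"
  shows "\<exists>\<rho>1 \<rho>2.
     \<rho>1 \<le> \<gamma> 0 \<and> \<gamma> 0 \<le> \<rho>2 \<and> {\<rho>\<in>{0..\<rho>j}. Q 0 \<rho> = Q k r} = {\<rho>1, \<rho>2} \<and>
     (s \<in> {0..\<rho>1} \<longrightarrow>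
        has_waves V \<rho>j (k, r) (0, s) u [Standing (k, r) (0, \<rho>1), Rarefaction (0, \<rho>1) (0, s)] \<and>
        boundary_flux V u (Q k r)) \<and>
     (s \<in> {\<rho>1<..<\<rho>2} \<longrightarrow>
        has_waves V \<rho>j (k, r) (0, s) u [Standing (k, r) (0, \<rho>1), Shock (0, \<rho>1) (0, s)] \<and>
        shock_speed V (0, \<rho>1) (0, s) > 0 \<and>
        boundary_flux V u (Q k r)) \<and>
     (s \<in> {\<rho>2..\<rho>j} \<longrightarrow>
        (\<exists>\<rho>'. {\<rho>\<in>{\<gamma> k..\<rho>j - k}. Q k \<rho> = Q 0 s} = {\<rho>'} \<and>
           has_waves V \<rho>j (k, r) (0, s) u [Shock (k, r) (k, \<rho>'), Standing (k, \<rho>') (0, s)] \<and>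
           shock_speed V (k, r) (k, \<rho>') \<le> 0 \<and>
           boundary_flux V u (Q 0 s)))"
proof -
  have "0 \<le> Q k r" "Q k r \<le> Q 0 (\<gamma> 0)"
    using Q_nonneg[OF k r] Q_le_Q\<gamma>[OF k r] capacity_le[OF k r s] by simp_all
  then obtain \<rho>1 \<rho>2 where \<rho>: "\<rho>1 \<in> {0..\<gamma> 0}" "\<rho>2 \<in> {\<gamma> 0..\<rho>j}" "Q 0 \<rho>1 = Q k r" "Q 0 \<rho>2 = Q k r"
    "{\<rho>\<in>{0..\<rho>j}. Q 0 \<rho> = Q k r} = {\<rho>1, \<rho>2}"
    by (rule flux_roots)
  have "left_trace k r r" using r by (simp add: left_trace_def)
  note up = flux_limited_upstream[OF this less_imp_le[OF assms] \<rho>(1-4)]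
  show ?thesis
  proof (rule exI[of _ \<rho>1], rule exI[of _ \<rho>2], intro conjI impI)
    assume "s \<in> {0..\<rho>1}"
    then show "has_waves V \<rho>j (k, r) (0, s) u [Standing (k, r) (0, \<rho>1), Rarefaction (0, \<rho>1) (0, s)]"
      "boundary_flux V u (Q k r)"
      using up by (auto simp: has_waves_def wave_list_def link_def simp del: flux.simps)
  next
    assume "s \<in> {\<rho>1<..<\<rho>2}"
    then show "has_waves V \<rho>j (k, r) (0, s) u [Standing (k, r) (0, \<rho>1), Shock (0, \<rho>1) (0, s)]"
      "0 < shock_speed V (0, \<rho>1) (0, s)" "boundary_flux V u (Q k r)"
      using up by (auto simp: has_waves_def wave_list_def link_def simp del: flux.simps)
  next
    assume s2: "s \<in> {\<rho>2..\<rho>j}"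
    then have "\<gamma> 0 \<le> s" using \<rho>(2) by simp
    have le: "Q 0 s \<le> Q k r"
      using s2 \<rho>(2,4) Q_decreasing[OF range_0'(1,2), of \<rho>2 s]
      by (cases "s = \<rho>2") (simp_all del: flux.simps)
    then have "Q 0 s \<le> partial_demand k r"
      using assms by (simp add: demand_eq k del: flux.simps)
    with \<open>\<gamma> 0 \<le> s\<close> obtain \<rho>' where \<rho>': "\<rho>' \<in> {\<gamma> k..\<rho>j - k}" "Q k \<rho>' = Q 0 s"
      "{\<rho>\<in>{\<gamma> k..\<rho>j - k}. Q k \<rho> = Q 0 s} = {\<rho>'}"
      "solves_with_waves V \<rho>j (k, r) (0, s) (wave_list k r \<rho>' s s) u" "boundary_flux V u (Q 0 s)"
      by (rule flux_limited_downstream)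
    have "r < \<rho>'" using assms \<rho>'(1) by simp
    moreover have "shock_speed V (k, r) (k, \<rho>') \<le> 0"
      using le \<rho>'(2) shock_speed_sign(1)[OF k \<open>r < \<rho>'\<close>] by (simp del: flux.simps)
    moreover have "has_waves V \<rho>j (k, r) (0, s) u [Shock (k, r) (k, \<rho>'), Standing (k, \<rho>') (0, s)]"
      using \<rho>'(4) \<open>r < \<rho>'\<close> by (simp add: has_waves_def wave_list_def split: if_splits)
    ultimately show "\<exists>\<rho>'. {\<rho>\<in>{\<gamma> k..\<rho>j - k}. Q k \<rho> = Q 0 s} = {\<rho>'} \<and>
       has_waves V \<rho>j (k, r) (0, s) u [Shock (k, r) (k, \<rho>'), Standing (k, \<rho>') (0, s)] \<and>
       shock_speed V (k, r) (k, \<rho>') \<le> 0 \<and> boundary_flux V u (Q 0 s)"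
      using \<rho>'(3,5) by blast
  qed (use \<rho> in \<open>simp_all del: flux.simps\<close>)
qed

lemma overcritical_types:
  assumes "\<gamma> k < r"
  shows "\<exists>\<rho>0 \<rho>1 \<rho>2.
     {\<rho>\<in>{\<gamma> 0..\<rho>j}. Q 0 \<rho> = Q k r} = {\<rho>0} \<and>
     \<rho>1 \<le> \<gamma> 0 \<and> \<gamma> 0 \<le> \<rho>2 \<and> {\<rho>\<in>{0..\<rho>j}. Q 0 \<rho> = Q k (\<gamma> k)} = {\<rho>1, \<rho>2} \<and>
     (s \<in> {0..\<rho>1} \<longrightarrow>
        has_waves V \<rho>j (k, r) (0, s) u
          [Rarefaction (k, r) (k, \<gamma> k), Standing (k, \<gamma> k) (0, \<rho>1), Rarefaction (0, \<rho>1) (0, s)] \<and>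
        boundary_flux V u (Q k (\<gamma> k))) \<and>
     (s \<in> {\<rho>1<..<\<rho>2} \<longrightarrow>
        has_waves V \<rho>j (k, r) (0, s) u
          [Rarefaction (k, r) (k, \<gamma> k), Standing (k, \<gamma> k) (0, \<rho>1), Shock (0, \<rho>1) (0, s)] \<and>
        shock_speed V (0, \<rho>1) (0, s) > 0 \<and>
        boundary_flux V u (Q k (\<gamma> k))) \<and>
     (s \<in> {\<rho>2..\<rho>0} \<longrightarrow>
        (\<exists>\<rho>'. {\<rho>\<in>{\<gamma> k..\<rho>j - k}. Q k \<rho> = Q 0 s} = {\<rho>'} \<and>
           has_waves V \<rho>j (k, r) (0, s) u [Rarefaction (k, r) (k, \<rho>'), Standing (k, \<rho>') (0, s)] \<and>
           boundary_flux V u (Q 0 s))) \<and>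
     (s \<in> {\<rho>0<..\<rho>j} \<longrightarrow>
        (\<exists>\<rho>'. {\<rho>\<in>{\<gamma> k..\<rho>j - k}. Q k \<rho> = Q 0 s} = {\<rho>'} \<and>
           has_waves V \<rho>j (k, r) (0, s) u [Shock (k, r) (k, \<rho>'), Standing (k, \<rho>') (0, s)] \<and>
           shock_speed V (k, r) (k, \<rho>') < 0 \<and>
           boundary_flux V u (Q 0 s)))"
proof -
  have "0 \<le> Q k (\<gamma> k)"
    using Q_nonneg[OF k \<gamma>_range[OF k]] .
  then obtain \<rho>1 \<rho>2 where \<rho>: "\<rho>1 \<in> {0..\<gamma> 0}" "\<rho>2 \<in> {\<gamma> 0..\<rho>j}"
    "Q 0 \<rho>1 = Q k (\<gamma> k)" "Q 0 \<rho>2 = Q k (\<gamma> k)" "{\<rho>\<in>{0..\<rho>j}. Q 0 \<rho> = Q k (\<gamma> k)} = {\<rho>1, \<rho>2}"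
    using capacity_le[OF k r s] by (rule flux_roots)
  have "0 \<le> Q k r" "Q k r \<le> Q 0 (\<gamma> 0)"
    using Q_nonneg[OF k r] Q_le_Q\<gamma>[OF k r] capacity_le[OF k r s] by simp_all
  then obtain \<rho>0 where \<rho>0: "\<rho>0 \<in> {\<gamma> 0..\<rho>j - 0}" "Q 0 \<rho>0 = Q k r"
    by (rule over_root[OF range_0'(1,2)])
  have "Q k r < Q k (\<gamma> k)"
    using Q_less_capacity[OF k r] assms by simp
  have demand: "partial_demand k r = Q k (\<gamma> k)"
    using assms by (simp add: demand_eq k del: flux.simps)
  then have "left_trace k r (\<gamma> k)"
    using \<gamma>_range[OF k] by (intro left_trace_over k r) auto
  note up = flux_limited_upstream[OF this order_refl \<rho>(1-4)]
  have \<rho>20: "\<rho>2 \<le> \<rho>0"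
    using Q_decreasing[OF range_0'(1,2), of \<rho>0 \<rho>2] \<rho>(2,4) \<rho>0 \<open>Q k r < Q k (\<gamma> k)\<close>
    by (cases "\<rho>0 < \<rho>2") (simp_all del: flux.simps)
  have down: "\<exists>\<rho>'. \<rho>' \<in> {\<gamma> k..\<rho>j - k} \<and> Q k \<rho>' = Q 0 s \<and> {\<rho>\<in>{\<gamma> k..\<rho>j - k}. Q k \<rho> = Q 0 s} = {\<rho>'} \<and>
      solves_with_waves V \<rho>j (k, r) (0, s) (wave_list k r \<rho>' s s) u \<and> boundary_flux V u (Q 0 s)"
    if "\<rho>2 \<le> s"
  proof -
    have "\<gamma> 0 \<le> s" using that \<rho>(2) by simp
    moreover have "Q 0 s \<le> partial_demand k r"
      using that s \<rho>(2,4) demand Q_decreasing[OF range_0'(1,2), of \<rho>2 s]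
      by (cases "s = \<rho>2") (simp_all del: flux.simps)
    ultimately show ?thesis by (rule flux_limited_downstream) blast
  qed
  show ?thesis
  proof (rule exI[of _ \<rho>0], rule exI[of _ \<rho>1], rule exI[of _ \<rho>2], intro conjI impI)
    show "{\<rho>\<in>{\<gamma> 0..\<rho>j}. Q 0 \<rho> = Q k r} = {\<rho>0}"
      using over_root_set[OF range_0'(1,2) \<rho>0] by simp
  next
    assume "s \<in> {0..\<rho>1}"
    then show "has_waves V \<rho>j (k, r) (0, s) u
        [Rarefaction (k, r) (k, \<gamma> k), Standing (k, \<gamma> k) (0, \<rho>1), Rarefaction (0, \<rho>1) (0, s)]"
      "boundary_flux V u (Q k (\<gamma> k))"
      using up assms by (auto simp: has_waves_def wave_list_def link_def simp del: flux.simps)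
  next
    assume "s \<in> {\<rho>1<..<\<rho>2}"
    then show "has_waves V \<rho>j (k, r) (0, s) u
        [Rarefaction (k, r) (k, \<gamma> k), Standing (k, \<gamma> k) (0, \<rho>1), Shock (0, \<rho>1) (0, s)]"
      "0 < shock_speed V (0, \<rho>1) (0, s)" "boundary_flux V u (Q k (\<gamma> k))"
      using up assms by (auto simp: has_waves_def wave_list_def link_def simp del: flux.simps)
  next
    assume s2: "s \<in> {\<rho>2..\<rho>0}"
    then obtain \<rho>' where \<rho>': "\<rho>' \<in> {\<gamma> k..\<rho>j - k}" "Q k \<rho>' = Q 0 s"
      "{\<rho>\<in>{\<gamma> k..\<rho>j - k}. Q k \<rho> = Q 0 s} = {\<rho>'}"
      "solves_with_waves V \<rho>j (k, r) (0, s) (wave_list k r \<rho>' s s) u" "boundary_flux V u (Q 0 s)"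
      using down s2 by auto
    have "Q k r \<le> Q 0 s"
      using Q_decreasing[OF range_0'(1,2), of s \<rho>0] s2 \<rho>(2) \<rho>0
      by (cases "s = \<rho>0") (auto simp del: flux.simps)
    then have "\<rho>' \<le> r"
      using Q_decreasing[OF k, of r \<rho>'] assms \<rho>'(1,2) by (cases "r < \<rho>'") (simp_all del: flux.simps)
    then have "has_waves V \<rho>j (k, r) (0, s) u [Rarefaction (k, r) (k, \<rho>'), Standing (k, \<rho>') (0, s)]"
      using \<rho>'(4) by (auto simp: has_waves_def wave_list_def link_def split: if_splits)
    then show "\<exists>\<rho>'. {\<rho>\<in>{\<gamma> k..\<rho>j - k}. Q k \<rho> = Q 0 s} = {\<rho>'} \<and>
       has_waves V \<rho>j (k, r) (0, s) u [Rarefaction (k, r) (k, \<rho>'), Standing (k, \<rho>') (0, s)] \<and>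
       boundary_flux V u (Q 0 s)"
      using \<rho>'(3,5) by blast
  next
    assume s0: "s \<in> {\<rho>0<..\<rho>j}"
    then obtain \<rho>' where \<rho>': "\<rho>' \<in> {\<gamma> k..\<rho>j - k}" "Q k \<rho>' = Q 0 s"
      "{\<rho>\<in>{\<gamma> k..\<rho>j - k}. Q k \<rho> = Q 0 s} = {\<rho>'}"
      "solves_with_waves V \<rho>j (k, r) (0, s) (wave_list k r \<rho>' s s) u" "boundary_flux V u (Q 0 s)"
      using down s0 \<rho>20 by auto
    have less: "Q k \<rho>' < Q k r"
      using Q_decreasing[OF range_0'(1,2), of \<rho>0 s] s0 \<rho>0 \<rho>'(2) by (auto simp del: flux.simps)
    then have "r < \<rho>'"
      using Q_decreasing[OF k, of \<rho>' r] r \<rho>'(1) by (cases r \<rho>' rule: linorder_cases) (auto simp del: flux.simps)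
    moreover have "shock_speed V (k, r) (k, \<rho>') < 0"
      using less \<open>r < \<rho>'\<close> by (simp add: shock_speed_def divide_neg_pos del: flux.simps)
    moreover have "has_waves V \<rho>j (k, r) (0, s) u [Shock (k, r) (k, \<rho>'), Standing (k, \<rho>') (0, s)]"
      using \<rho>'(4) \<open>r < \<rho>'\<close> by (simp add: has_waves_def wave_list_def split: if_splits)
    ultimately show "\<exists>\<rho>'. {\<rho>\<in>{\<gamma> k..\<rho>j - k}. Q k \<rho> = Q 0 s} = {\<rho>'} \<and>
       has_waves V \<rho>j (k, r) (0, s) u [Shock (k, r) (k, \<rho>'), Standing (k, \<rho>') (0, s)] \<and>
       shock_speed V (k, r) (k, \<rho>') < 0 \<and> boundary_flux V u (Q 0 s)"
      using \<rho>'(3,5) by blast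
  qed (use \<rho> in \<open>simp_all del: flux.simps\<close>)
qed

end

end

theorem mainTheorem3:
  fixes V :: "real \<Rightarrow> real" and \<rho>j kL \<rho>L \<rho>R :: real and UL UR :: state
  assumes "speed_density V \<rho>j"
    and "0 \<le> kL" "kL \<le> \<rho>j"
    and "0 \<le> \<rho>L" "\<rho>L \<le> \<rho>j - kL"
    and "0 \<le> \<rho>R" "\<rho>R \<le> \<rho>j"
    and "UL = (kL, \<rho>L)" and "UR = (0, \<rho>R)"
  shows
    "(\<exists>u. wave_solution V \<rho>j UL UR u) \<and>
     (\<forall>u. wave_solution V \<rho>j UL UR u \<longrightarrow>
        (undercritical V \<rho>j UL \<longrightarrow>
          (\<exists>\<rho>1 \<rho>2.
             \<rho>1 \<le> crit_density V \<rho>j 0 \<and> crit_density V \<rho>j 0 \<le> \<rho>2 \<and>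
             {\<rho>\<in>{0..\<rho>j}. flux V (0, \<rho>) = flux V UL} = {\<rho>1, \<rho>2} \<and>
             (\<rho>R \<in> {0..\<rho>1} \<longrightarrow>
                has_waves V \<rho>j UL UR u [Standing UL (0, \<rho>1), Rarefaction (0, \<rho>1) UR] \<and>
                boundary_flux V u (flux V UL)) \<and>
             (\<rho>R \<in> {\<rho>1<..<\<rho>2} \<longrightarrow>
                has_waves V \<rho>j UL UR u [Standing UL (0, \<rho>1), Shock (0, \<rho>1) UR] \<and>
                shock_speed V (0, \<rho>1) UR > 0 \<and>
                boundary_flux V u (flux V UL)) \<and>
             (\<rho>R \<in> {\<rho>2..\<rho>j} \<longrightarrow>
                (\<exists>\<rho>'. {\<rho>\<in>{crit_density V \<rho>j kL..\<rho>j - kL}. flux V (kL, \<rho>) = flux V UR} = {\<rho>'} \<and>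
                   has_waves V \<rho>j UL UR u [Shock UL (kL, \<rho>'), Standing (kL, \<rho>') UR] \<and>
                   shock_speed V UL (kL, \<rho>') \<le> 0 \<and>
                   boundary_flux V u (flux V UR))))) \<and>
        (overcritical V \<rho>j UL \<longrightarrow>
          (\<exists>Ustar \<rho>0 \<rho>1 \<rho>2.
             Ustar = (kL, crit_density V \<rho>j kL) \<and>
             flux V Ustar = capacity V \<rho>j kL \<and>
             {\<rho>\<in>{crit_density V \<rho>j 0..\<rho>j}. flux V (0, \<rho>) = flux V UL} = {\<rho>0} \<and>
             \<rho>1 \<le> crit_density V \<rho>j 0 \<and> crit_density V \<rho>j 0 \<le> \<rho>2 \<and>
             {\<rho>\<in>{0..\<rho>j}. flux V (0, \<rho>) = flux V Ustar} = {\<rho>1, \<rho>2} \<and>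
             (\<rho>R \<in> {0..\<rho>1} \<longrightarrow>
                has_waves V \<rho>j UL UR u
                  [Rarefaction UL Ustar, Standing Ustar (0, \<rho>1), Rarefaction (0, \<rho>1) UR] \<and>
                boundary_flux V u (capacity V \<rho>j kL)) \<and>
             (\<rho>R \<in> {\<rho>1<..<\<rho>2} \<longrightarrow>
                has_waves V \<rho>j UL UR u
                  [Rarefaction UL Ustar, Standing Ustar (0, \<rho>1), Shock (0, \<rho>1) UR] \<and>
                shock_speed V (0, \<rho>1) UR > 0 \<and>
                boundary_flux V u (capacity V \<rho>j kL)) \<and>
             (\<rho>R \<in> {\<rho>2..\<rho>0} \<longrightarrow>
                (\<exists>\<rho>'. {\<rho>\<in>{crit_density V \<rho>j kL..\<rho>j - kL}. flux V (kL, \<rho>) = flux V UR} = {\<rho>'} \<and>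
                   has_waves V \<rho>j UL UR u [Rarefaction UL (kL, \<rho>'), Standing (kL, \<rho>') UR] \<and>
                   boundary_flux V u (flux V UR))) \<and>
             (\<rho>R \<in> {\<rho>0<..\<rho>j} \<longrightarrow>
                (\<exists>\<rho>'. {\<rho>\<in>{crit_density V \<rho>j kL..\<rho>j - kL}. flux V (kL, \<rho>) = flux V UR} = {\<rho>'} \<and>
                   has_waves V \<rho>j UL UR u [Shock UL (kL, \<rho>'), Standing (kL, \<rho>') UR] \<and>
                   shock_speed V UL (kL, \<rho>') < 0 \<and>
                   boundary_flux V u (flux V UR))))) \<and>
        boundary_flux V u (min (traffic_supply V \<rho>j UR) (traffic_demand V \<rho>j UL)))"
proof -
  interpret fundamental_diagram V \<rho>j
    by unfold_locales (rule assms(1))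
  have k: "0 \<le> kL" "kL \<le> \<rho>j" "\<rho>L \<in> {0..\<rho>j - kL}" "\<rho>R \<in> {0..\<rho>j}"
    using assms(2-7) by auto
  show ?thesis
    unfolding \<open>UL = (kL, \<rho>L)\<close> \<open>UR = (0, \<rho>R)\<close> capacity_eq[OF k(1,2)]
      undercritical.simps overcritical.simps
    apply (intro conjI allI impI)
       apply (rule wave_solution_exists[OF k])
      apply (rule undercritical_types[OF k]; assumption)
     apply (rule exI[of _ "(kL, \<gamma> kL)"])
     apply (simp only: simp_thms)
     apply (rule overcritical_types[OF k]; assumption)
    apply (rule boundary_flux_min[OF k])
    apply assumption
    done
qed

end
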